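(* Let $k\ge2$ and $L=\{E\}$ with $E$ a $k$-ary relation symbol. Suppose $\gamma:\mathbb N\to[0,1]$ satisfies $\lim_{n\to\infty}\gamma(n)=0$. Then there is an extended $L$-hypergraphon $W$ that induces a Borel hypergraph and such that $h_{G(\mathbb N,W)}(n)=o(n^k)$ and $h_{G(\mathbb N,W)}(n)=\Omega(\gamma(n)\cdot n^k)$.
   Context: Notation: $[n]=\{0,\dots,n-1\}$, $[\mathbb N]=\mathbb N$; $\mathfrak P_{<k}(\mathfrak n)$, $\mathfrak P_k(\mathfrak n)$, $\mathfrak P_{\le k}(\mathfrak n)$ are the subsets of $[\mathfrak n]$ of size $<k$, $=k$, $\le k$. Entropy of a Borel probability measure $\nu$ with atom set $A$: $h(\nu)=-\sum_{x\in A}\nu(\{x\})\log_2\nu(\{x\})$ if $\nu(A)=1$, else $\infty$. A complete non-redundant quantifier-free $L$-type in variables $x_0,\dots,x_{k-1}$ is a maximal consistent set of atomic and negated atomic $L$-formulas with free variables among $x_0,\dots,x_{k-1}$ containing $x_i\ne x_j$ for all $i<j<k$; $\mathfrak{qf}^{\mathrm{nr}}_L$ is the space of these, and $\mathcal P(\mathfrak{qf}^{\mathrm{nr}}_L)$ its space of Borel probability measures. $\mathrm{Sym}(k)$ acts on types by $\sigma\cdot u=\{\varphi(x_{\sigma(i_0)},\dots,x_{\sigma(i_{\ell-1})}):\varphi(x_{i_0},\dots,x_{i_{\ell-1}})\in u\}$ and on measures by pushforward. An extended $L$-hypergraphon is a measurable $W:[0,1]^{\mathfrak P_{<k}(k)}\to\mathcal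 P(\mathfrak{qf}^{\mathrm{nr}}_L)$ with $W(\langle x_{\sigma(F)}\rangle_F)=\sigma\cdot W(\langle x_F\rangle_F)$ for all $\sigma\in\mathrm{Sym}(k)$. Let $\delta_\top,\delta_\bot$ be the point masses at the unique types containing $\bigwedge_{\sigma\in\mathrm{Sym}(k)}E(x_{\sigma(0)},\dots,x_{\sigma(k-1)})$, resp. $\bigwedge_\sigma\neg E(x_{\sigma(0)},\dots,x_{\sigma(k-1)})$. $W$ induces a Borel hypergraph if (i) $W(\hat x_{[k]})=W(\hat y_{[k]})$ for a.e. pair $\hat x_{[k]},\hat y_{[k]}\in[0,1]^{\mathfrak P_{<k}(k)}$ with $x_{\{i\}}=y_{\{i\}}$ for all $i\in[k]$, and (ii) $W(\hat x_{[k]})\in\{\delta_\top,\delta_\bot\}$ for a.e. $\hat x_{[k]}$. Fix measurable $W^*:[0,1]^{\mathfrak P_{<k}(k)}\times[0,1]\to\mathfrak{qf}^{\mathrm{nr}}_L$ with $W^*(t,\zeta)$ distributed as $W(t)$ for uniform $\zeta$. For $J\in\mathfrak P_k(\mathfrak n)$ let $\tau_J:[k]\to J$ be the increasing bijection and $\hat x_J=\langle x_{\tau_J(F)}\rangle_{F\in\mathfrak P_{<k}(k)}$. With $\langle\zeta_D\rangle_{D\in\mathfrak P_{\le k}(\mathbb N)}$ i.i.d. uniform on $[0,1]$, $G(\mathfrak n,W)$ is the random $L$-structure on $[\mathfrak n]$ in which, for each $J\in\mathfrak P_k(\mathfrak n)$, the quantifier-free type of $\langle\tau_J(0),\dots,\tau_J(k-1)\rangle$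 is $W^*(\hat\zeta_J,\zeta_J)$. $h_{G(\mathbb N,W)}(n)$ is the entropy of the distribution of the restriction of $G(\mathbb N,W)$ to $[n]$. *)

theory Defs
  imports "HOL-Probability.Probability" "HOL-Combinatorics.Permutations"
    "HOL-Library.Landau_Symbols"
begin

section \<open>Structures and quantifier-free types for one \<open>k\<close>-ary relation symbol\<close>

text \<open>
  Structures are non-redundant throughout: the relation holds only of tuples of pairwise distinct
  elements. Without this convention the types \<open>type_top\<close>, \<open>type_bot\<close> below would not be unique, and
  prescribing the types of all increasing \<open>k\<close>-tuples would not determine a structure.
  A structure on \<open>V\<close> is identified with its relation, a set of lists of length \<open>k\<close>.
\<close>

definition structures :: "nat \<Rightarrow> 'a set \<Rightarrow> 'a list set set" where
  "structures k V = {M. \<forall>a\<in>M. length a = k \<and> set a \<subseteq> V \<and> distinct a}"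

text \<open>Type parameter \<open>'v\<close>: names of the variables; \<open>i :: nat\<close> names \<open>x\<^sub>i\<close>.\<close>

datatype 'v atomic = Eq 'v 'v | Rel "'v list"
datatype 'v literal = Pos "'v atomic" | Neg "'v atomic"

definition literals :: "nat \<Rightarrow> nat literal set" where
  "literals k = (let At = {Eq i j | i j. i < k \<and> j < k} \<union> {Rel is | is. length is = k \<and> set is \<subseteq> {..<k}}
     in Pos ` At \<union> Neg ` At)"

fun holds :: "'a list set \<Rightarrow> ('v \<Rightarrow> 'a) \<Rightarrow> 'v literal \<Rightarrow> bool" where
  "holds M v (Pos (Eq i j)) \<longleftrightarrow> v i = v j"
| "holds M v (Pos (Rel is)) \<longleftrightarrow> map v is \<in> M"
| "holds M v (Neg (Eq i j)) \<longleftrightarrow> v i \<noteq> v j"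
| "holds M v (Neg (Rel is)) \<longleftrightarrow> map v is \<notin> M"

definition qftp :: "nat \<Rightarrow> 'a list set \<Rightarrow> (nat \<Rightarrow> 'a) \<Rightarrow> nat literal set" where
  "qftp k M v = {l \<in> literals k. holds M v l}"

text \<open>
  Satisfiability is tested in structures on the natural numbers only; this is no restriction since
  just \<open>k\<close> variables are interpreted and non-redundant structures are closed under substructures
  and under adding isolated points.
\<close>

definition consistent :: "nat \<Rightarrow> nat literal set \<Rightarrow> bool" where
  "consistent k u \<longleftrightarrow> (\<exists>M \<in> structures k (UNIV :: nat set). \<exists>v. \<forall>l\<in>u. holds M v l)"

definition qf_nr :: "nat \<Rightarrow> nat literal set set" where
  "qf_nr k = {u. u \<subseteq> literals k \<and> consistent k u \<and>
     (\<forall>u'. u \<subset> u' \<and> u' \<subseteq> literals k \<longrightarrow> \<not> consistent k u') \<and>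
     (\<forall>i j. i < j \<and> j < k \<longrightarrow> Neg (Eq i j) \<in> u)}"

abbreviation type_act :: "(nat \<Rightarrow> nat) \<Rightarrow> nat literal set \<Rightarrow> nat literal set" where
  "type_act \<sigma> u \<equiv> map_literal \<sigma> ` u"

definition type_top :: "nat \<Rightarrow> nat literal set" where
  "type_top k = (THE u. u \<in> qf_nr k \<and> (\<forall>\<sigma>. \<sigma> permutes {..<k} \<longrightarrow> Pos (Rel (map \<sigma> [0..<k])) \<in> u))"

definition type_bot :: "nat \<Rightarrow> nat literal set" where
  "type_bot k = (THE u. u \<in> qf_nr k \<and> (\<forall>\<sigma>. \<sigma> permutes {..<k} \<longrightarrow> Neg (Rel (map \<sigma> [0..<k])) \<in> u))"

text \<open>
  The language is finite, so \<open>qf_nr k\<close> is finite and discrete: its Borel sets are all its subsets, and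
  the Borel \<open>\<sigma>\<close>-algebra on its probability measures is the one generated by the evaluation maps, as
  in \<open>prob_algebra\<close>.
\<close>

abbreviation qf_space :: "nat \<Rightarrow> nat literal set measure" where
  "qf_space k \<equiv> count_space (qf_nr k)"

section \<open>Extended hypergraphons\<close>

abbreviation unif :: "real measure" where
  "unif \<equiv> restrict_space lborel {0..1}"

abbreviation P_lt :: "nat \<Rightarrow> nat set \<Rightarrow> nat set set" where
  "P_lt k V \<equiv> {F. F \<subseteq> V \<and> finite F \<and> card F < k}"

abbreviation P_eq :: "nat \<Rightarrow> nat set \<Rightarrow> nat set set" where
  "P_eq k V \<equiv> {F. F \<subseteq> V \<and> finite F \<and> card F = k}"

abbreviation P_le :: "nat \<Rightarrow> nat set \<Rightarrow> nat set set" where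
  "P_le k V \<equiv> {F. F \<subseteq> V \<and> finite F \<and> card F \<le> k}"

abbreviation cube :: "nat set set \<Rightarrow> (nat set \<Rightarrow> real) measure" where
  "cube I \<equiv> PiM I (\<lambda>_. unif)"

type_synonym hypergraphon = "(nat set \<Rightarrow> real) \<Rightarrow> nat literal set measure"

definition ext_hypergraphon :: "nat \<Rightarrow> hypergraphon \<Rightarrow> bool" where
  "ext_hypergraphon k W \<longleftrightarrow>
     W \<in> cube (P_lt k {..<k}) \<rightarrow>\<^sub>M prob_algebra (qf_space k) \<and>
     (\<forall>\<sigma>. \<sigma> permutes {..<k} \<longrightarrow> (\<forall>x \<in> space (cube (P_lt k {..<k})).
        W (\<lambda>F \<in> P_lt k {..<k}. x (\<sigma> ` F)) = distr (W x) (qf_space k) (type_act \<sigma>)))"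

text \<open>
  In the first condition, pairs of points that agree on the singleton coordinates are sampled by
  sharing the singleton coordinates \<open>z\<close> and choosing the remaining ones \<open>a\<close>, \<open>b\<close> independently.
\<close>

definition induces_borel_hypergraph :: "nat \<Rightarrow> hypergraphon \<Rightarrow> bool" where
  "induces_borel_hypergraph k W \<longleftrightarrow>
     (let S = {{i} | i. i < k}; R = P_lt k {..<k} - S in
       AE (z, a, b) in cube S \<Otimes>\<^sub>M (cube R \<Otimes>\<^sub>M cube R). W (merge S R (z, a)) = W (merge S R (z, b))) \<and>
     (AE x in cube (P_lt k {..<k}).
        W x \<in> {return (qf_space k) (type_top k), return (qf_space k) (type_bot k)})"

section \<open>The sampled random structure and its entropy\<close>

definition represents :: "nat \<Rightarrow> hypergraphon \<Rightarrow> ((nat set \<Rightarrow> real) \<times> real \<Rightarrow> nat literal set) \<Rightarrow> bool" where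
  "represents k W Ws \<longleftrightarrow>
     Ws \<in> cube (P_lt k {..<k}) \<Otimes>\<^sub>M unif \<rightarrow>\<^sub>M qf_space k \<and>
     (\<forall>t \<in> space (cube (P_lt k {..<k})). distr unif (qf_space k) (\<lambda>\<zeta>. Ws (t, \<zeta>)) = W t)"

definition Wstar :: "nat \<Rightarrow> hypergraphon \<Rightarrow> (nat set \<Rightarrow> real) \<times> real \<Rightarrow> nat literal set" where
  "Wstar k W = (SOME Ws. represents k W Ws)"

definition tau :: "nat set \<Rightarrow> nat \<Rightarrow> nat" where
  "tau J i = sorted_list_of_set J ! i"

definition hat :: "nat \<Rightarrow> (nat set \<Rightarrow> real) \<Rightarrow> nat set \<Rightarrow> (nat set \<Rightarrow> real)" where
  "hat k x J = (\<lambda>F \<in> P_lt k {..<k}. x (tau J ` F))"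

definition sample :: "nat \<Rightarrow> hypergraphon \<Rightarrow> (nat set \<Rightarrow> real) \<Rightarrow> nat list set" where
  "sample k W \<zeta> = (THE M. M \<in> structures k UNIV \<and>
     (\<forall>J \<in> P_eq k UNIV. qftp k M (tau J) = Wstar k W (hat k \<zeta> J, \<zeta> J)))"

definition sample_law :: "nat \<Rightarrow> hypergraphon \<Rightarrow> nat \<Rightarrow> nat list set measure" where
  "sample_law k W n = distr (cube (P_le k UNIV)) (count_space (structures k {..<n}))
     (\<lambda>\<zeta>. {a \<in> sample k W \<zeta>. set a \<subseteq> {..<n}})"

definition shannon_entropy :: "'a measure \<Rightarrow> ennreal" where
  "shannon_entropy \<nu> = (let A = {x \<in> space \<nu>. measure \<nu> {x} \<noteq> 0} in
     if measure \<nu> A = 1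
     then \<integral>\<^sup>+ x. ennreal (- measure \<nu> {x} * log 2 (measure \<nu> {x})) \<partial>count_space A
     else \<infinity>)"

definition entropy_fun :: "nat \<Rightarrow> hypergraphon \<Rightarrow> nat \<Rightarrow> ennreal" where
  "entropy_fun k W n = shannon_entropy (sample_law k W n)"

section \<open>The descriptions and choices above are well defined\<close>

lemma finite_literals: "finite (literals k)"
proof -
  have "{Eq i j | i j. i < k \<and> j < k} = (\<lambda>(i, j). Eq i j) ` ({..<k} \<times> {..<k})" by auto
  moreover have "finite {is. set is \<subseteq> {..<k} \<and> length is = k}" by (rule finite_lists_length_eq) simp
  then have "finite (Rel ` {is. set is \<subseteq> {..<k} \<and> length is = k})" by simp
  moreover have "Rel ` {is. set is \<subseteq> {..<k} \<and> length is = k} = {Rel is | is. length is = k \<and> set is \<subseteq> {..<k}}"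
    by auto
  ultimately show ?thesis by (simp add: literals_def Let_def)
qed

lemma literals_simps [simp]:
  "Pos (Eq i j) \<in> literals k \<longleftrightarrow> i < k \<and> j < k"
  "Neg (Eq i j) \<in> literals k \<longleftrightarrow> i < k \<and> j < k"
  "Pos (Rel is) \<in> literals k \<longleftrightarrow> length is = k \<and> set is \<subseteq> {..<k}"
  "Neg (Rel is) \<in> literals k \<longleftrightarrow> length is = k \<and> set is \<subseteq> {..<k}"
  by (auto simp: literals_def Let_def)

lemma literals_complete:
  assumes "l \<in> literals k"
  obtains l' where "l' \<in> literals k" "\<And>M v. holds M v l' \<longleftrightarrow> \<not> holds (M :: 'a list set) v l"
proof -
  have "\<exists>l' \<in> literals k. \<forall>M v. holds M v l' \<longleftrightarrow> \<not> holds (M :: 'a list set) v l"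
  proof (cases l)
    case (Pos a)
    then show ?thesis using assms by (intro bexI[of _ "Neg a"]; cases a) auto
  next
    case (Neg a)
    then show ?thesis using assms by (intro bexI[of _ "Pos a"]; cases a) auto
  qed
  then show ?thesis using that by blast
qed

lemma qf_nr_iff:
  "u \<in> qf_nr k \<longleftrightarrow> (\<exists>M \<in> structures k (UNIV :: nat set). \<exists>v. inj_on v {..<k} \<and> u = qftp k M v)"
proof
  assume u: "u \<in> qf_nr k"
  then obtain M :: "nat list set" and v where M: "M \<in> structures k UNIV" "\<forall>l\<in>u. holds M v l"
    by (auto simp: qf_nr_def consistent_def)
  have "u \<subseteq> qftp k M v" using u M by (auto simp: qf_nr_def qftp_def)
  moreover have "consistent k (qftp k M v)" "qftp k M v \<subseteq> literals k"
    using M by (auto simp: consistent_def qftp_def)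
  ultimately have eq: "u = qftp k M v" using u unfolding qf_nr_def by blast
  have ne: "v i \<noteq> v j" if "i < j" "j < k" for i j
    using u M that by (force simp: qf_nr_def)
  have "inj_on v {..<k}"
    by (rule inj_onI) (metis lessThan_iff linorder_neqE_nat ne)
  with eq M show "\<exists>M \<in> structures k (UNIV :: nat set). \<exists>v. inj_on v {..<k} \<and> u = qftp k M v" by blast
next
  assume "\<exists>M \<in> structures k (UNIV :: nat set). \<exists>v. inj_on v {..<k} \<and> u = qftp k M v"
  then obtain M :: "nat list set" and v where
    M: "M \<in> structures k UNIV" "inj_on v {..<k}" "u = qftp k M v" by blast
  have "\<not> consistent k u'" if sub: "u \<subset> u'" "u' \<subseteq> literals k" for u'
  proof
    assume "consistent k u'"
    then obtain N :: "nat list set" and w where N: "\<forall>l\<in>u'. holds N w l" by (auto simp: consistent_def)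
    from sub obtain l where l: "l \<in> u'" "l \<notin> u" by blast
    obtain l' where l': "l' \<in> literals k" "\<And>M v. holds M v l' \<longleftrightarrow> \<not> holds (M :: nat list set) v l"
      using literals_complete[of l k] l sub(2) by blast
    have "l' \<in> u'" using l l' sub M(3) by (auto simp: qftp_def)
    with N l l' show False by blast
  qed
  moreover have "consistent k u" using M by (auto simp: consistent_def qftp_def)
  moreover have "Neg (Eq i j) \<in> u" if "i < j" "j < k" for i j
    using M that by (auto simp: qftp_def dest: inj_onD)
  ultimately show "u \<in> qf_nr k" using M(3) by (auto simp: qf_nr_def qftp_def)
qed

lemma finite_qf_nr: "finite (qf_nr k)"
  by (rule finite_subset[OF _ finite_Pow_iff[THEN iffD2, OF finite_literals[of k]]])
     (auto simp: qf_nr_def)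

lemma qf_nr_eqI:
  assumes u: "u \<in> qf_nr k" and u': "u' \<in> qf_nr k"
    and iff: "\<And>is. length is = k \<Longrightarrow> set is \<subseteq> {..<k} \<Longrightarrow> distinct is \<Longrightarrow>
      Pos (Rel is) \<in> u \<longleftrightarrow> Pos (Rel is) \<in> u'"
  shows "u = u'"
proof -
  obtain M v M' v' where M: "M \<in> structures k (UNIV :: nat set)" "inj_on v {..<k}" "u = qftp k M v"
    and M': "M' \<in> structures k (UNIV :: nat set)" "inj_on v' {..<k}" "u' = qftp k M' v'"
    using u u' by (auto simp: qf_nr_iff)
  have rel: "map v is \<in> M \<longleftrightarrow> map v' is \<in> M'" if "length is = k" "set is \<subseteq> {..<k}" for "is"
  proof (cases "distinct is")
    case True
    then show ?thesis using iff[OF that] M(3) M'(3) that by (auto simp: qftp_def)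
  next
    case False
    then show ?thesis using M(1) M'(1) by (auto simp: structures_def distinct_map)
  qed
  have eq: "v i = v j \<longleftrightarrow> v' i = v' j" if "i < k" "j < k" for i j
    using M(2) M'(2) that by (auto dest: inj_onD)
  have "holds M v l \<longleftrightarrow> holds M' v' l" if "l \<in> literals k" for l
  proof (cases l)
    case (Pos a)
    then show ?thesis using that rel eq by (cases a) auto
  next
    case (Neg a)
    then show ?thesis using that rel eq by (cases a) auto
  qed
  then show ?thesis using M(3) M'(3) by (auto simp: qftp_def)
qed

lemma distinct_list_permutes:
  assumes "length is = k" "set is \<subseteq> {..<k}" "distinct is"
  obtains \<sigma> where "\<sigma> permutes {..<k}" "is = map \<sigma> [0..<k]"
proof -
  define \<sigma> where "\<sigma> = (\<lambda>i. if i < k then is ! i else i)"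
  have set: "set is = {..<k}"
    by (rule card_subset_eq) (use assms distinct_card[OF assms(3)] in simp_all)
  have img: "\<sigma> ` {..<k} = {..<k}"
  proof -
    have "\<sigma> ` {..<k} = (!) is ` {..<k}" by (rule image_cong) (simp_all add: \<sigma>_def)
    also have "\<dots> = set is" using assms(1) by (simp add: set_conv_nth image_def) blast
    finally show ?thesis using set by simp
  qed
  have "bij_betw \<sigma> {..<k} {..<k}"
    unfolding bij_betw_def using img by (simp add: eq_card_imp_inj_on)
  then have "\<sigma> permutes {..<k}" by (rule bij_imp_permutes) (simp add: \<sigma>_def)
  moreover have "is = map \<sigma> [0..<k]"
    using assms(1) by (intro nth_equalityI) (simp_all add: \<sigma>_def)
  ultimately show ?thesis by (rule that)
qed

lemma permutes_list:
  assumes "\<sigma> permutes {..<k}"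
  shows "set (map \<sigma> [0..<k]) \<subseteq> {..<k}" "distinct (map \<sigma> [0..<k])"
proof -
  have "set (map \<sigma> [0..<k]) = \<sigma> ` {..<k}" by (simp add: atLeast0LessThan)
  then show "set (map \<sigma> [0..<k]) \<subseteq> {..<k}" using permutes_image[OF assms] by simp
  show "distinct (map \<sigma> [0..<k])" using permutes_inj_on[OF assms] by (simp add: distinct_map)
qed

lemma type_top_unique:
  "\<exists>!u. u \<in> qf_nr k \<and> (\<forall>\<sigma>. \<sigma> permutes {..<k} \<longrightarrow> Pos (Rel (map \<sigma> [0..<k])) \<in> u)"
proof (rule ex_ex1I)
  define M :: "nat list set" where "M = {a. length a = k \<and> distinct a}"
  have "M \<in> structures k UNIV" by (auto simp: M_def structures_def)
  then have "qftp k M id \<in> qf_nr k" unfolding qf_nr_iff by (intro bexI[of _ M] exI[of _ id]) auto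
  moreover have "Pos (Rel (map \<sigma> [0..<k])) \<in> qftp k M id" if "\<sigma> permutes {..<k}" for \<sigma>
    using permutes_list[OF that] by (auto simp: qftp_def M_def)
  ultimately show "\<exists>u. u \<in> qf_nr k \<and> (\<forall>\<sigma>. \<sigma> permutes {..<k} \<longrightarrow> Pos (Rel (map \<sigma> [0..<k])) \<in> u)"
    by blast
next
  fix u u'
  assume *: "u \<in> qf_nr k \<and> (\<forall>\<sigma>. \<sigma> permutes {..<k} \<longrightarrow> Pos (Rel (map \<sigma> [0..<k])) \<in> u)"
    "u' \<in> qf_nr k \<and> (\<forall>\<sigma>. \<sigma> permutes {..<k} \<longrightarrow> Pos (Rel (map \<sigma> [0..<k])) \<in> u')"
  show "u = u'" using * by (intro qf_nr_eqI[of _ k]) (metis distinct_list_permutes)+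
qed

lemma type_bot_unique:
  "\<exists>!u. u \<in> qf_nr k \<and> (\<forall>\<sigma>. \<sigma> permutes {..<k} \<longrightarrow> Neg (Rel (map \<sigma> [0..<k])) \<in> u)"
proof (rule ex_ex1I)
  have "{} \<in> structures k (UNIV :: nat set)" by (auto simp: structures_def)
  then have "qftp k ({} :: nat list set) id \<in> qf_nr k"
    unfolding qf_nr_iff by (intro bexI[of _ "{}"] exI[of _ id]) auto
  moreover have "Neg (Rel (map \<sigma> [0..<k])) \<in> qftp k ({} :: nat list set) id" if "\<sigma> permutes {..<k}" for \<sigma>
    using permutes_list[OF that] by (auto simp: qftp_def)
  ultimately show "\<exists>u. u \<in> qf_nr k \<and> (\<forall>\<sigma>. \<sigma> permutes {..<k} \<longrightarrow> Neg (Rel (map \<sigma> [0..<k])) \<in> u)"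
    by blast
next
  fix u u'
  assume *: "u \<in> qf_nr k \<and> (\<forall>\<sigma>. \<sigma> permutes {..<k} \<longrightarrow> Neg (Rel (map \<sigma> [0..<k])) \<in> u)"
    "u' \<in> qf_nr k \<and> (\<forall>\<sigma>. \<sigma> permutes {..<k} \<longrightarrow> Neg (Rel (map \<sigma> [0..<k])) \<in> u')"
  have no: "\<not> (Pos (Rel is) \<in> w \<and> Neg (Rel is) \<in> w)" if "w \<in> qf_nr k" for w "is"
    using that by (auto simp: qf_nr_iff qftp_def)
  show "u = u'"
  proof (rule qf_nr_eqI[of _ k])
    fix "is" :: "nat list" assume "length is = k" "set is \<subseteq> {..<k}" "distinct is"
    then obtain \<sigma> where "\<sigma> permutes {..<k}" "is = map \<sigma> [0..<k]" by (rule distinct_list_permutes)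
    with * no show "Pos (Rel is) \<in> u \<longleftrightarrow> Pos (Rel is) \<in> u'" by blast
  qed (use * in auto)
qed

lemma tau_bij: "J \<in> P_eq k UNIV \<Longrightarrow> bij_betw (tau J) {..<k} J"
  unfolding tau_def
  using bij_betw_nth[of "sorted_list_of_set J" "{..<k}" J] by simp

lemma sample_unique:
  assumes "\<And>J. J \<in> P_eq k UNIV \<Longrightarrow> w J \<in> qf_nr k"
  shows "\<exists>!M. M \<in> structures k UNIV \<and> (\<forall>J \<in> P_eq k UNIV. qftp k M (tau J) = w J)"
proof (rule ex_ex1I)
  have dist: "distinct is" "length is = k" "set is \<subseteq> {..<k}"
    if J: "J \<in> P_eq k UNIV" and rel: "Pos (Rel is) \<in> w J" for J "is"
  proof -
    obtain M v where M: "M \<in> structures k (UNIV :: nat set)" "w J = qftp k M v"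
      using assms[OF J] by (auto simp: qf_nr_iff)
    then have "map v is \<in> M" using rel by (simp add: qftp_def)
    then have "distinct (map v is)" using M(1) by (auto simp: structures_def)
    then show "distinct is" by (simp add: distinct_map)
    show "length is = k" "set is \<subseteq> {..<k}" using M(2) rel by (simp_all add: qftp_def)
  qed
  have img: "set (map (tau J) is) = J"
    if "J \<in> P_eq k UNIV" "distinct is" "length is = k" "set is \<subseteq> {..<k}" for J "is"
  proof -
    have "set is = {..<k}" using that by (metis card_lessThan card_subset_eq distinct_card finite_lessThan)
    then show ?thesis using tau_bij[OF that(1)] by (simp add: bij_betw_def)
  qed
  define M where "M = {map (tau J) is | J is. J \<in> P_eq k UNIV \<and> Pos (Rel is) \<in> w J}"
  have M: "M \<in> structures k UNIV"
  proof -
    have "distinct (map (tau J) is)" if "J \<in> P_eq k UNIV" "Pos (Rel is) \<in> w J" for J "is"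
      using dist[OF that] tau_bij[OF that(1)] by (auto simp: distinct_map bij_betw_def intro: inj_on_subset)
    then show ?thesis using dist by (auto simp: M_def structures_def)
  qed
  have "qftp k M (tau J) = w J" if J: "J \<in> P_eq k UNIV" for J
  proof (rule qf_nr_eqI[of _ k])
    show "qftp k M (tau J) \<in> qf_nr k"
      using M tau_bij[OF J] by (auto simp: qf_nr_iff bij_betw_def)
    show "w J \<in> qf_nr k" using assms J .
    fix "is" assume i: "length is = k" "set is \<subseteq> {..<k}" "distinct is"
    have "Pos (Rel is) \<in> w J" if "J' \<in> P_eq k UNIV" "Pos (Rel is') \<in> w J'"
      "map (tau J) is = map (tau J') is'" for J' is'
    proof -
      have "J = J'" using img[OF J i(3,1,2)] img[OF that(1) dist[OF that(1,2)]] that(3) by simp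
      moreover have "is = is'"
        using that(3) i(2) dist(3)[OF that(1,2)] tau_bij[OF J] \<open>J = J'\<close>
        by (auto simp: bij_betw_def intro: map_inj_on inj_on_subset)
      ultimately show ?thesis using that by simp
    qed
    then show "Pos (Rel is) \<in> qftp k M (tau J) \<longleftrightarrow> Pos (Rel is) \<in> w J"
      using J i by (auto simp: qftp_def M_def)
  qed
  with M show "\<exists>M. M \<in> structures k UNIV \<and> (\<forall>J \<in> P_eq k UNIV. qftp k M (tau J) = w J)" by blast
next
  fix M N
  assume *: "M \<in> structures k UNIV \<and> (\<forall>J \<in> P_eq k UNIV. qftp k M (tau J) = w J)"
    "N \<in> structures k UNIV \<and> (\<forall>J \<in> P_eq k UNIV. qftp k N (tau J) = w J)"
  have "a \<in> M \<longleftrightarrow> a \<in> N" for a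
  proof (cases "length a = k \<and> distinct a")
    case True
    then have J: "set a \<in> P_eq k UNIV" by (auto simp: distinct_card)
    have sub: "set a \<subseteq> tau (set a) ` {..<k}" using tau_bij[OF J] by (simp add: bij_betw_def)
    define "is" where "is = map (the_inv_into {..<k} (tau (set a))) a"
    have inj: "inj_on (tau (set a)) {..<k}" using tau_bij[OF J] by (simp add: bij_betw_def)
    have a: "map (tau (set a)) is = a"
      unfolding is_def map_map
      by (rule map_idI) (use sub f_the_inv_into_f[OF inj] in auto)
    have "set is \<subseteq> {..<k}" "length is = k"
      using True sub the_inv_into_into[OF inj _ subset_refl] by (auto simp: is_def)
    then have "Pos (Rel is) \<in> qftp k M' (tau (set a)) \<longleftrightarrow> a \<in> M'" for M'
      using a by (simp add: qftp_def)
    moreover have "qftp k M (tau (set a)) = qftp k N (tau (set a))" using * J by simp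
    ultimately show ?thesis by blast
  next
    case False
    then show ?thesis using * by (auto simp: structures_def)
  qed
  then show "M = N" by blast
qed

lemma represents_Wstar:
  assumes W: "ext_hypergraphon k W"
  shows "represents k W (Wstar k W)"
proof -
  let ?C = "cube (P_lt k {..<k})" and ?Q = "qf_nr k"
  have Wm: "W \<in> ?C \<rightarrow>\<^sub>M prob_algebra (qf_space k)" using W by (simp add: ext_hypergraphon_def)
  then have Wm': "W \<in> ?C \<rightarrow>\<^sub>M subprob_algebra (qf_space k)" by (rule measurable_prob_algebraD)
  obtain e where e: "bij_betw e {0..<card ?Q} ?Q" using ex_bij_betw_nat_finite[OF finite_qf_nr] by blast
  define m where "m = card ?Q"
  have eQ: "e j \<in> ?Q" if "j < m" for j using e that by (auto simp: bij_betw_def m_def)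
  define S where "S t j = (\<Sum>i<j. measure (W t) {e i})" for t j
  have mono: "S t i \<le> S t j" if "i \<le> j" for t i j
    unfolding S_def by (rule sum_mono2) (use that in auto)
  have Wt: "prob_space (W t)" "sets (W t) = Pow ?Q" "space (W t) = ?Q" if "t \<in> space ?C" for t
  proof -
    have *: "W t \<in> space (prob_algebra (qf_space k))" by (rule measurable_space[OF Wm that])
    then show "prob_space (W t)" "sets (W t) = Pow ?Q" by (auto simp: space_prob_algebra)
    from * have "sets (W t) = sets (qf_space k)" by (simp add: space_prob_algebra)
    from sets_eq_imp_space_eq[OF this] show "space (W t) = ?Q" by simp
  qed
  have Sm: "S t m = 1" if "t \<in> space ?C" for t
  proof -
    interpret prob_space "W t" by (rule Wt[OF that])
    have "S t m = (\<Sum>u\<in>?Q. measure (W t) {u})"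
      unfolding S_def m_def
      using sum.reindex_bij_betw[OF e, of "\<lambda>u. measure (W t) {u}"] by (simp add: atLeast0LessThan)
    also have "\<dots> = measure (W t) ?Q"
      by (rule finite_measure_eq_sum_singleton[symmetric]) (auto simp: finite_qf_nr Wt(2)[OF that])
    finally show ?thesis using prob_space Wt(3)[OF that] by simp
  qed
  define I where "I = (\<lambda>(t, \<zeta>). LEAST j. \<zeta> \<le> S t (Suc j))"
  have Ilt: "I (t, \<zeta>) < m" if "t \<in> space ?C" "\<zeta> \<in> {0..1}" for t \<zeta>
  proof -
    have "m \<noteq> 0" using Sm[OF that(1)] by (intro notI) (simp add: S_def)
    then obtain m' where m': "m = Suc m'" by (cases m) auto
    then have "\<zeta> \<le> S t (Suc m')" using Sm[OF that(1)] that(2) by simp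
    then have "I (t, \<zeta>) \<le> m'" unfolding I_def by (auto intro: Least_le)
    then show ?thesis using m' by simp
  qed
  have Iiff: "I (t, \<zeta>) = j \<longleftrightarrow> \<zeta> \<le> S t (Suc j) \<and> (j = 0 \<or> S t j < \<zeta>)"
    if "t \<in> space ?C" "\<zeta> \<in> {0..1}" for t \<zeta> j
  proof -
    have ex: "\<zeta> \<le> S t (Suc (I (t, \<zeta>)))"
    proof -
      have "\<zeta> \<le> S t (Suc m)" using Sm[OF that(1)] that(2) mono[of m "Suc m" t] by auto
      then show ?thesis unfolding I_def by (auto intro: LeastI)
    qed
    show ?thesis
    proof
      assume j: "I (t, \<zeta>) = j"
      have "S t j < \<zeta>" if nz: "j \<noteq> 0"
      proof -
        obtain i where i: "j = Suc i" using nz by (cases j) auto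
        then have "i < (LEAST j. \<zeta> \<le> S t (Suc j))" using j by (simp add: I_def)
        from not_less_Least[OF this] show ?thesis using i by simp
      qed
      with ex j show "\<zeta> \<le> S t (Suc j) \<and> (j = 0 \<or> S t j < \<zeta>)" by blast
    next
      assume j: "\<zeta> \<le> S t (Suc j) \<and> (j = 0 \<or> S t j < \<zeta>)"
      have "(LEAST j. \<zeta> \<le> S t (Suc j)) = j"
      proof (rule Least_equality)
        fix i assume i: "\<zeta> \<le> S t (Suc i)"
        show "j \<le> i"
        proof (rule ccontr)
          assume "\<not> j \<le> i"
          then have "S t (Suc i) \<le> S t j" by (intro mono) simp
          with i j \<open>\<not> j \<le> i\<close> show False by auto
        qed
      qed (use j in simp)
      then show "I (t, \<zeta>) = j" by (simp add: I_def)
    qed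
  qed
  have S_meas: "(\<lambda>t. S t j) \<in> borel_measurable ?C" if "j \<le> m" for j
    unfolding S_def
  proof (rule borel_measurable_sum)
    fix i assume "i \<in> {..<j}"
    then have "{e i} \<in> sets (qf_space k)" using eQ that by auto
    then show "(\<lambda>t. measure (W t) {e i}) \<in> borel_measurable ?C"
      by (rule measurable_compose[OF Wm' measurable_measure_subprob_algebra])
  qed
  have I_meas: "{x \<in> space (?C \<Otimes>\<^sub>M unif). I x = j} \<in> sets (?C \<Otimes>\<^sub>M unif)" if "j < m" for j
  proof -
    have [measurable]: "(\<lambda>x. S (fst x) j) \<in> borel_measurable (?C \<Otimes>\<^sub>M unif)"
      "(\<lambda>x. S (fst x) (Suc j)) \<in> borel_measurable (?C \<Otimes>\<^sub>M unif)"
      by (rule measurable_compose[OF measurable_fst S_meas], use that in simp)+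
    have "(\<lambda>y. y) \<in> unif \<rightarrow>\<^sub>M borel" by (rule measurable_restrict_space1) simp
    from measurable_compose[OF measurable_snd this]
    have [measurable]: "snd \<in> borel_measurable (?C \<Otimes>\<^sub>M unif)" .
    have "{x \<in> space (?C \<Otimes>\<^sub>M unif). I x = j} =
      {x \<in> space (?C \<Otimes>\<^sub>M unif). snd x \<le> S (fst x) (Suc j) \<and> (j = 0 \<or> S (fst x) j < snd x)}"
    proof (rule Collect_cong, rule conj_cong[OF refl])
      fix x assume "x \<in> space (?C \<Otimes>\<^sub>M unif)"
      then have "fst x \<in> space ?C" "snd x \<in> {0..1}"
        by (auto simp: space_pair_measure space_restrict_space)
      from Iiff[OF this, of j]
      show "I x = j \<longleftrightarrow> snd x \<le> S (fst x) (Suc j) \<and> (j = 0 \<or> S (fst x) j < snd x)" by simp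
    qed
    also have "\<dots> \<in> sets (?C \<Otimes>\<^sub>M unif)" by measurable
    finally show ?thesis .
  qed
  have Ilt': "I x < m" if "x \<in> space (?C \<Otimes>\<^sub>M unif)" for x
    using that Ilt by (cases x) (auto simp: space_pair_measure space_restrict_space)
  have inj: "e i = e j \<longleftrightarrow> i = j" if "i < m" "j < m" for i j
    using e that by (auto simp: bij_betw_def m_def dest: inj_onD)
  have Qe: "\<exists>j<m. u = e j" if "u \<in> ?Q" for u
    using e that unfolding bij_betw_def m_def by (metis atLeastLessThan_iff imageE)
  have meas: "(\<lambda>x. e (I x)) \<in> ?C \<Otimes>\<^sub>M unif \<rightarrow>\<^sub>M qf_space k"
    unfolding measurable_count_space_eq2[OF finite_qf_nr]
  proof (intro conjI ballI funcsetI)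
    fix u assume "u \<in> ?Q"
    then obtain j where j: "j < m" "u = e j" using Qe by blast
    then have "(\<lambda>x. e (I x)) -` {u} \<inter> space (?C \<Otimes>\<^sub>M unif) = {x \<in> space (?C \<Otimes>\<^sub>M unif). I x = j}"
      using inj Ilt' by blast
    with I_meas[OF j(1)] show "(\<lambda>x. e (I x)) -` {u} \<inter> space (?C \<Otimes>\<^sub>M unif) \<in> sets (?C \<Otimes>\<^sub>M unif)"
      by simp
  qed (use eQ Ilt' in blast)
  have dist: "distr unif (qf_space k) (\<lambda>\<zeta>. e (I (t, \<zeta>))) = W t" if t: "t \<in> space ?C" for t
  proof (rule measure_eqI_finite[OF _ Wt(2)[OF t] finite_qf_nr])
    fix u assume "u \<in> ?Q"
    then obtain j where j: "j < m" "u = e j" using Qe by blast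
    interpret prob_space "W t" by (rule Wt[OF t])
    have m1: "(\<lambda>\<zeta>. e (I (t, \<zeta>))) \<in> unif \<rightarrow>\<^sub>M qf_space k"
      using measurable_compose[OF measurable_Pair1'[OF t] meas] by simp
    have set_eq: "(\<lambda>\<zeta>. e (I (t, \<zeta>))) -` {u} \<inter> {0..1} = {\<zeta> \<in> {0..1}. I (t, \<zeta>) = j}"
      using inj Ilt[OF t] j by blast
    have S01: "0 \<le> S t j" "S t j \<le> S t (Suc j)" "S t (Suc j) \<le> 1"
      using mono[of 0 j t] mono[of j "Suc j" t] mono[of "Suc j" m t] Sm[OF t] j(1) by (auto simp: S_def)
    have Ieq: "{\<zeta> \<in> {0..1}. I (t, \<zeta>) = j} =
        {\<zeta> \<in> {0..1}. \<zeta> \<le> S t (Suc j) \<and> (j = 0 \<or> S t j < \<zeta>)}"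
      using Iiff[OF t] by (intro Collect_cong conj_cong) simp_all
    have "emeasure lborel {\<zeta> \<in> {0..1}. I (t, \<zeta>) = j} = ennreal (S t (Suc j) - S t j)"
    proof (cases "j = 0")
      case True
      then have "{\<zeta> \<in> {0..1}. I (t, \<zeta>) = j} = {0..S t (Suc j)}"
        unfolding Ieq using S01 by auto
      moreover have "S t j = 0" using True by (simp add: S_def)
      ultimately show ?thesis using S01 by simp
    next
      case False
      then have "{\<zeta> \<in> {0..1}. I (t, \<zeta>) = j} = {S t j<..S t (Suc j)}"
        unfolding Ieq using S01 by auto
      then show ?thesis using S01 by simp
    qed
    also have "S t (Suc j) - S t j = measure (W t) {u}" by (simp add: S_def j)
    finally have "emeasure unif ((\<lambda>\<zeta>. e (I (t, \<zeta>))) -` {u} \<inter> space unif) = emeasure (W t) {u}"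
      using set_eq emeasure_restrict_space[of "{0..1}" lborel "{\<zeta> \<in> {0..1}. I (t, \<zeta>) = j}"]
      by (simp add: space_restrict_space emeasure_eq_measure subset_iff)
    then show "emeasure (distr unif (qf_space k) (\<lambda>\<zeta>. e (I (t, \<zeta>)))) {u} = emeasure (W t) {u}"
      using \<open>u \<in> ?Q\<close> by (simp add: emeasure_distr[OF m1])
  qed simp
  have "represents k W (\<lambda>x. e (I x))" unfolding represents_def using meas dist by simp
  then show ?thesis unfolding Wstar_def by (rule someI[of "represents k W"])
qed

end

theory Submission
  imports Defs
begin

text \<open>
  Divide the unit interval into levels \<open>l = 0, 1, \<dots>\<close> of mass \<open>2\<^sup>-\<^sup>l\<^sup>-\<^sup>1\<close>, and give the vertices of level
  \<open>l\<close> a uniform position below \<open>m l\<close> and a uniform table of bits indexed by sets of positions. A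
  \<open>k\<close>-set of vertices is an edge iff all of them have the same level and the table of the vertex with
  smallest position has a one at the set of all positions. Only singleton coordinates matter, so this is
  a Borel hypergraph. If \<open>m l\<close> is large compared with \<open>n\<^sup>2\<close>, the positions at level \<open>l\<close> are distinct
  with high probability; given levels and positions the edges inside level \<open>l\<close> are then
  independent fair coins, so that the entropy is at least of order \<open>2\<^sup>-\<^sup>l\<^sup>k n\<^sup>k\<close>. Letting \<open>m\<close> grow so
  fast that level \<open>l\<close> serves all \<open>n\<close> until \<open>\<gamma>\<close> has dropped below \<open>2\<^sup>-\<^sup>(\<^sup>l\<^sup>+\<^sup>2\<^sup>)\<^sup>k\<close> gives the lower bound.
  Conversely, revealing all cells of level below \<open>l\<close> costs entropy linear in \<open>n\<close> and leaves an expected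
  number of at most \<open>2\<^sup>-\<^sup>l n\<^sup>k\<close> undecided \<open>k\<close>-sets.
\<close>

section \<open>Entropy of finitely supported distributions\<close>

text \<open>On an infinite support the sum defaults to 0; for finite supports the value is the
  Shannon entropy in bits.\<close>

definition pmf_entropy :: "'a pmf \<Rightarrow> real" where
  "pmf_entropy p = (\<Sum>x\<in>set_pmf p. - pmf p x * log 2 (pmf p x))"

lemma entropy_summand_nonneg: "0 \<le> - pmf p x * log 2 (pmf p x)"
proof (cases "pmf p x = 0")
  case False
  then have "log 2 (pmf p x) \<le> 0" using pmf_le_1[of p x] pmf_nonneg[of p x] by simp
  then show ?thesis using mult_nonneg_nonpos[OF pmf_nonneg[of p x]] by simp
qed simp

lemma pmf_entropy_nonneg: "pmf_entropy p \<ge> 0"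
  unfolding pmf_entropy_def by (intro sum_nonneg entropy_summand_nonneg)

lemma pmf_entropy_eq_expectation:
  assumes "finite (set_pmf p)"
  shows "pmf_entropy p = measure_pmf.expectation p (\<lambda>x. - log 2 (pmf p x))"
  unfolding pmf_entropy_def
  by (subst integral_measure_pmf_real[OF assms]) (auto simp: mult.commute set_pmf_iff)

lemma pmf_entropy_fst:
  assumes "finite (set_pmf R)"
  shows "pmf_entropy (map_pmf fst R) = measure_pmf.expectation R (\<lambda>x. - log 2 (pmf (map_pmf fst R) (fst x)))"
  using assms by (subst pmf_entropy_eq_expectation) auto

lemma log2_le_minus_one: "log 2 x \<le> (x - 1) / ln 2" if "x > 0" for x :: real
  unfolding log_def using that by (intro divide_right_mono ln_le_minus_one) auto

text \<open>Conditioning does not raise entropy: the hypothesis bounds the conditional probabilities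
  of \<open>g\<close> given \<open>c\<close>, and thereby the conditional entropy from below by the
  mean of \<open>s\<close>. Both steps merge into one Gibbs estimate comparing the joint law with
  the product of its marginals.\<close>

lemma pmf_entropy_fst_ge:
  fixes R :: "('g \<times> 'c) pmf" and s :: "'c \<Rightarrow> real"
  assumes fin: "finite (set_pmf R)"
    and le: "\<And>g c. (g, c) \<in> set_pmf R \<Longrightarrow> pmf R (g, c) \<le> pmf (map_pmf snd R) c * 2 powr (- s c)"
  shows "measure_pmf.expectation R (\<lambda>x. s (snd x)) \<le> pmf_entropy (map_pmf fst R)"
proof -
  define p where "p = map_pmf fst R"
  define w where "w = map_pmf snd R"
  have int: "integrable R f" for f :: "'g \<times> 'c \<Rightarrow> real"
    by (rule integrable_measure_pmf_finite[OF fin])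
  have pos: "pmf p (fst x) > 0" "pmf w (snd x) > 0" "pmf R x > 0" if "x \<in> set_pmf R" for x
    using that by (auto simp: p_def w_def intro!: pmf_positive)
  have "measure_pmf.expectation R (\<lambda>x. s (snd x) + log 2 (pmf p (fst x)))
      \<le> measure_pmf.expectation R (\<lambda>x. (pmf w (snd x) * pmf p (fst x) / pmf R x - 1) / ln 2)"
  proof (intro integral_mono_AE int AE_pmfI)
    fix x assume x: "x \<in> set_pmf R"
    have "pmf R x \<le> pmf w (snd x) * 2 powr (- s (snd x))"
      using le[of "fst x" "snd x"] x by (simp add: w_def)
    then have "2 powr s (snd x) \<le> pmf w (snd x) / pmf R x"
      using pos[OF x] by (simp add: powr_minus field_simps)
    then have "s (snd x) \<le> log 2 (pmf w (snd x) / pmf R x)"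
      using pos[OF x] by (subst le_log_iff) auto
    then have "s (snd x) + log 2 (pmf p (fst x)) \<le> log 2 (pmf w (snd x) * pmf p (fst x) / pmf R x)"
      using pos[OF x] by (simp add: log_mult log_divide)
    also have "\<dots> \<le> (pmf w (snd x) * pmf p (fst x) / pmf R x - 1) / ln 2"
      using pos[OF x] by (intro log2_le_minus_one) simp
    finally show "s (snd x) + log 2 (pmf p (fst x)) \<le> \<dots>" .
  qed
  also have "\<dots> = (measure_pmf.expectation R (\<lambda>x. pmf w (snd x) * pmf p (fst x) / pmf R x) - 1) / ln 2"
    using int by simp
  also have "measure_pmf.expectation R (\<lambda>x. pmf w (snd x) * pmf p (fst x) / pmf R x)
      = (\<Sum>x\<in>set_pmf R. pmf w (snd x) * pmf p (fst x))"
    by (subst integral_measure_pmf_real[OF fin]) (auto simp: set_pmf_iff intro!: sum.cong)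
  \<comment> \<open>The support of \<open>R\<close> lies in the product of the marginal supports, on
    which the product of the marginals has total mass 1.\<close>
  also have "\<dots> \<le> (\<Sum>x\<in>set_pmf p \<times> set_pmf w. pmf w (snd x) * pmf p (fst x))"
    using fin by (intro sum_mono2) (force simp: p_def w_def)+
  also have "\<dots> = (\<Sum>g\<in>set_pmf p. pmf p g) * (\<Sum>c\<in>set_pmf w. pmf w c)"
    by (simp add: sum_product sum.cartesian_product case_prod_beta mult.commute[of "pmf w _"])
  also have "\<dots> = 1"
    using fin by (subst (1 2) sum_pmf_eq_1) (auto simp: p_def w_def)
  finally show ?thesis
    using int pmf_entropy_fst[OF fin] by (simp add: p_def divide_right_mono)
qed

text \<open>Describing \<open>c\<close> costs at most the logarithm of the number of its values, and
  then \<open>g\<close> costs at most \<open>t c\<close> bits. Formally this is Gibbs' inequality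
  against the subprobability weights \<open>q\<close>: \<open>c\<close> is uniform on
  \<open>Y\<close>, and every \<open>g\<close> compatible with \<open>c\<close> gets weight
  \<open>2 powr (- t c)\<close>.\<close>

lemma pmf_entropy_fst_le:
  fixes R :: "('g \<times> 'c) pmf" and t :: "'c \<Rightarrow> real"
  assumes fin: "finite (set_pmf R)"
    and le: "\<And>c. real (card {g. (g, c) \<in> set_pmf R}) \<le> 2 powr t c"
  shows "pmf_entropy (map_pmf fst R) \<le>
    log 2 (card (snd ` set_pmf R)) + measure_pmf.expectation R (\<lambda>x. t (snd x))"
proof -
  define p where "p = map_pmf fst R"
  define Y where "Y = snd ` set_pmf R"
  define q where "q g = (\<Sum>c\<in>Y. if (g, c) \<in> set_pmf R then 2 powr (- t c) / card Y else 0)" for g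
  have finY: "finite Y" using fin by (simp add: Y_def)
  have cardY: "card Y > 0" using finY set_pmf_not_empty[of R] by (auto simp: Y_def card_gt_0_iff)
  have int: "integrable R f" for f :: "'g \<times> 'c \<Rightarrow> real"
    by (rule integrable_measure_pmf_finite[OF fin])
  have pos: "pmf p (fst x) > 0" if "x \<in> set_pmf R" for x
    using that by (auto simp: p_def intro!: pmf_positive)
  have "measure_pmf.expectation R (\<lambda>x. - log 2 (pmf p (fst x)) - log 2 (card Y) - t (snd x))
      \<le> measure_pmf.expectation R (\<lambda>x. (q (fst x) / pmf p (fst x) - 1) / ln 2)"
  proof (intro integral_mono_AE int AE_pmfI)
    fix x assume x: "x \<in> set_pmf R"
    then have "snd x \<in> Y" by (simp add: Y_def)
    have q: "2 powr (- t (snd x)) / card Y \<le> q (fst x)"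
    proof -
      have "2 powr (- t (snd x)) / card Y = (\<Sum>c\<in>{snd x}. if (fst x, c) \<in> set_pmf R then 2 powr (- t c) / card Y else 0)"
        using x by simp
      also have "\<dots> \<le> q (fst x)"
        unfolding q_def using finY \<open>snd x \<in> Y\<close> by (intro sum_mono2) auto
      finally show ?thesis .
    qed
    have "- log 2 (pmf p (fst x)) - log 2 (card Y) - t (snd x) = log 2 (2 powr (- t (snd x)) / card Y / pmf p (fst x))"
      using pos[OF x] cardY by (simp add: log_divide log_mult)
    also have "\<dots> \<le> log 2 (q (fst x) / pmf p (fst x))"
      using pos[OF x] cardY divide_right_mono[OF q, of "pmf p (fst x)"]
      by (intro log_mono) (auto intro!: divide_pos_pos)
    also have "\<dots> \<le> (q (fst x) / pmf p (fst x) - 1) / ln 2"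
      using pos[OF x] cardY by (intro log2_le_minus_one divide_pos_pos less_le_trans[OF _ q]) simp_all
    finally show "- log 2 (pmf p (fst x)) - log 2 (card Y) - t (snd x) \<le> \<dots>" .
  qed
  also have "\<dots> = (measure_pmf.expectation R (\<lambda>x. q (fst x) / pmf p (fst x)) - 1) / ln 2"
    using int by simp
  also have "measure_pmf.expectation R (\<lambda>x. q (fst x) / pmf p (fst x)) = measure_pmf.expectation p (\<lambda>g. q g / pmf p g)"
    by (simp add: p_def)
  also have "\<dots> = (\<Sum>g\<in>set_pmf p. q g)"
  proof -
    have "finite (set_pmf p)" using fin by (simp add: p_def)
    then show ?thesis
      by (subst integral_measure_pmf_real[of "set_pmf p"]) (auto simp: pmf_eq_0_set_pmf intro!: sum.cong)
  qed
  also have "\<dots> = (\<Sum>c\<in>Y. \<Sum>g\<in>set_pmf p. if (g, c) \<in> set_pmf R then 2 powr (- t c) / card Y else 0)"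
    unfolding q_def by (rule sum.swap)
  also have "\<dots> \<le> (\<Sum>c\<in>Y. 1 / card Y)"
  proof (rule sum_mono)
    fix c
    have "(\<Sum>g\<in>set_pmf p. if (g, c) \<in> set_pmf R then 2 powr (- t c) / card Y else 0)
      = (\<Sum>g\<in>{g. (g, c) \<in> set_pmf R}. 2 powr (- t c) / card Y)"
    proof (rule sum.mono_neutral_cong_right)
      show "{g. (g, c) \<in> set_pmf R} \<subseteq> set_pmf p" by (force simp: p_def)
    qed (use fin in \<open>auto simp: p_def\<close>)
    also have "\<dots> = real (card {g. (g, c) \<in> set_pmf R}) * 2 powr (- t c) / card Y" by simp
    also have "\<dots> \<le> 2 powr t c * 2 powr (- t c) / card Y"
      by (intro divide_right_mono mult_right_mono le) auto
    also have "\<dots> = 1 / card Y" by (simp flip: powr_add)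
    finally show "(\<Sum>g\<in>set_pmf p. if (g, c) \<in> set_pmf R then 2 powr (- t c) / card Y else 0) \<le> 1 / card Y" .
  qed
  also have "\<dots> = 1" using cardY by simp
  finally have "measure_pmf.expectation R (\<lambda>x. - log 2 (pmf p (fst x)) - log 2 (card Y) - t (snd x)) \<le> 0"
    by (simp add: divide_right_mono)
  then show ?thesis using int pmf_entropy_fst[OF fin] by (simp add: p_def Y_def)
qed

text \<open>Passes to random variables on a common space: the joint law of \<open>G\<close> and
  \<open>c\<close> takes the role of \<open>R\<close>.\<close>

lemma pmf_entropy_map_ge:
  fixes P :: "'w pmf" and s :: "'c \<Rightarrow> real"
  assumes fin: "finite (G ` set_pmf P)" "finite (c ` set_pmf P)"
    and le: "\<And>\<omega>. \<omega> \<in> set_pmf P \<Longrightarrow> measure_pmf.prob P {\<omega>'. G \<omega>' = G \<omega> \<and> c \<omega>' = c \<omega>} \<le>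
      measure_pmf.prob P {\<omega>'. c \<omega>' = c \<omega>} * 2 powr (- s (c \<omega>))"
  shows "measure_pmf.expectation P (\<lambda>\<omega>. s (c \<omega>)) \<le> pmf_entropy (map_pmf G P)"
proof -
  define R where "R = map_pmf (\<lambda>\<omega>. (G \<omega>, c \<omega>)) P"
  have R: "map_pmf fst R = map_pmf G P" "map_pmf snd R = map_pmf c P"
    by (simp_all add: R_def pmf.map_comp o_def)
  have "finite (set_pmf R)"
    by (rule finite_subset[OF _ finite_cartesian_product[OF fin]]) (auto simp: R_def)
  then have "measure_pmf.expectation R (\<lambda>x. s (snd x)) \<le> pmf_entropy (map_pmf fst R)"
  proof (rule pmf_entropy_fst_ge)
    fix g l assume "(g, l) \<in> set_pmf R"
    then obtain \<omega> where "\<omega> \<in> set_pmf P" "g = G \<omega>" "l = c \<omega>" by (auto simp: R_def)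
    then show "pmf R (g, l) \<le> pmf (map_pmf snd R) l * 2 powr (- s l)"
      using le[of \<omega>] unfolding R by (simp add: R_def pmf_map vimage_def)
  qed
  then show ?thesis by (simp add: R(1)) (simp add: R_def)
qed

lemma pmf_entropy_map_le:
  fixes P :: "'w pmf" and t :: "'c \<Rightarrow> real"
  assumes fin: "finite (G ` set_pmf P)" "finite C" and sub: "c ` set_pmf P \<subseteq> C"
    and le: "\<And>l. real (card (G ` {\<omega> \<in> set_pmf P. c \<omega> = l})) \<le> 2 powr t l"
  shows "pmf_entropy (map_pmf G P) \<le> log 2 (card C) + measure_pmf.expectation P (\<lambda>\<omega>. t (c \<omega>))"
proof -
  define R where "R = map_pmf (\<lambda>\<omega>. (G \<omega>, c \<omega>)) P"
  have R: "map_pmf fst R = map_pmf G P" "snd ` set_pmf R = c ` set_pmf P"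
    by (simp_all add: R_def pmf.map_comp o_def image_image)
  have "finite (set_pmf R)"
    by (rule finite_subset[OF _ finite_cartesian_product[OF fin]]) (use sub in \<open>auto simp: R_def\<close>)
  then have "pmf_entropy (map_pmf fst R) \<le>
    log 2 (card (snd ` set_pmf R)) + measure_pmf.expectation R (\<lambda>x. t (snd x))"
  proof (rule pmf_entropy_fst_le)
    fix l
    have "{g. (g, l) \<in> set_pmf R} = G ` {\<omega> \<in> set_pmf P. c \<omega> = l}" by (auto simp: R_def)
    then show "real (card {g. (g, l) \<in> set_pmf R}) \<le> 2 powr t l" using le by simp
  qed
  then have 1: "pmf_entropy (map_pmf G P) \<le>
      log 2 (card (c ` set_pmf P)) + measure_pmf.expectation P (\<lambda>\<omega>. t (c \<omega>))"
    unfolding R by (simp add: R_def)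
  have "card (c ` set_pmf P) > 0"
    using finite_subset[OF sub fin(2)] set_pmf_not_empty[of P] by (auto simp: card_gt_0_iff)
  moreover have "card (c ` set_pmf P) \<le> card C" by (rule card_mono[OF fin(2) sub])
  ultimately have "log 2 (card (c ` set_pmf P)) \<le> log 2 (card C)" by simp
  with 1 show ?thesis by simp
qed

section \<open>The random structure determined by independent cells\<close>

text \<open>
  A cell \<open>(l, r, B)\<close> is the part of the unit interval on which a vertex has level \<open>l\<close>, position \<open>r\<close>
  and table \<open>B\<close>; the table lists sets of positions. A set of vertices of one level is an edge if the
  vertex of smallest position finds the set of all their positions in its table. The value of
  \<open>edge\<close> at vertices sharing a position is irrelevant.
\<close>

type_synonym cell = "nat \<times> nat \<times> nat set set"

abbreviation level :: "cell \<Rightarrow> nat" where "level c \<equiv> fst c"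
abbreviation pos :: "cell \<Rightarrow> nat" where "pos c \<equiv> fst (snd c)"
abbreviation tab :: "cell \<Rightarrow> nat set set" where "tab c \<equiv> snd (snd c)"

definition edge :: "cell set \<Rightarrow> bool" where
  "edge C \<longleftrightarrow> (\<exists>l. level ` C = {l}) \<and> (\<exists>c\<in>C. pos c = Min (pos ` C) \<and> pos ` C \<in> tab c)"

definition cell_structure :: "nat \<Rightarrow> nat \<Rightarrow> (nat \<Rightarrow> cell) \<Rightarrow> nat list set" where
  "cell_structure k n \<omega> = {a. length a = k \<and> distinct a \<and> set a \<subseteq> {..<n} \<and> edge (\<omega> ` set a)}"

definition cell_pmf :: "(nat \<Rightarrow> nat) \<Rightarrow> cell pmf" where
  "cell_pmf m = bind_pmf (geometric_pmf (1/2)) (\<lambda>l. map_pmf (Pair l)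
     (pair_pmf (pmf_of_set {..<m l}) (pmf_of_set (Pow (Pow {..<m l})))))"

text \<open>The default \<open>undefined\<close> makes the samples extensional, so that this law
  lives on the same functions as the product measure over \<open>{..<n}\<close>.\<close>

definition cells_pmf :: "(nat \<Rightarrow> nat) \<Rightarrow> nat \<Rightarrow> (nat \<Rightarrow> cell) pmf" where
  "cells_pmf m n = Pi_pmf {..<n} undefined (\<lambda>_. cell_pmf m)"

section \<open>The law of one cell and of independent cells\<close>

lemma pmf_bind_Pair:
  "pmf (bind_pmf L (\<lambda>l. map_pmf (Pair l) (K l))) (l, x) = pmf L l * pmf (K l) x"
proof -
  \<comment> \<open>The first component identifies the branch: only \<open>l' = l\<close> can
    produce \<open>(l, x)\<close>.\<close>
  have "pmf (map_pmf (Pair l') (K l')) (l, x) = (if l' = l then pmf (K l) x else 0)" for l'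
    using pmf_map_inj'[of "Pair l'" "K l'" x] by (auto simp: pmf_eq_0_set_pmf inj_on_def)
  then have "pmf (bind_pmf L (\<lambda>l. map_pmf (Pair l) (K l))) (l, x) =
      measure_pmf.expectation L (\<lambda>l'. if l' = l then pmf (K l) x else 0)"
    by (simp add: pmf_bind)
  also have "\<dots> = pmf L l * pmf (K l) x"
    by (subst integral_measure_pmf_real[of "{l}"]) (auto split: if_splits)
  finally show ?thesis .
qed

lemma pmf_cell_pmf:
  "pmf (cell_pmf m) (l, r, B) =
    (1/2) ^ Suc l * pmf (pmf_of_set {..<m l}) r * pmf (pmf_of_set (Pow (Pow {..<m l}))) B"
  unfolding cell_pmf_def by (simp add: pmf_bind_Pair pmf_pair)

lemma set_cell_pmf:
  assumes "\<And>l. m l > 0"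
  shows "set_pmf (cell_pmf m) = {(l, r, B). r < m l \<and> B \<subseteq> Pow {..<m l}}"
proof -
  have "set_pmf (pmf_of_set {..<m l}) = {..<m l}" for l using assms[of l] by (intro set_pmf_of_set) auto
  moreover have "set_pmf (pmf_of_set (Pow (Pow {..<m l}))) = Pow (Pow {..<m l})" for l
    by (intro set_pmf_of_set) auto
  ultimately show ?thesis by (auto simp: cell_pmf_def set_pmf_geometric)
qed

lemma prob_level: "measure_pmf.prob (cell_pmf m) {c. level c = l} = (1/2) ^ Suc l"
proof -
  have "map_pmf fst (cell_pmf m) = geometric_pmf (1/2)"
    by (simp add: cell_pmf_def map_bind_pmf pmf.map_comp o_def bind_return_pmf' map_pmf_const)
  then have "pmf (map_pmf fst (cell_pmf m)) l = (1/2) ^ Suc l" by simp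
  then show ?thesis by (simp add: pmf_map vimage_def)
qed

lemma prob_level_ge: "measure_pmf.prob (cell_pmf m) {c. level c \<ge> l} = (1/2) ^ l"
proof -
  have "map_pmf fst (cell_pmf m) = geometric_pmf (1/2)"
    by (simp add: cell_pmf_def map_bind_pmf pmf.map_comp o_def bind_return_pmf' map_pmf_const)
  then have "measure_pmf.prob (cell_pmf m) {c. level c < l} = measure_pmf.prob (geometric_pmf (1/2)) {..<l}"
    using measure_map_pmf[of fst "cell_pmf m" "{..<l}"] by (simp add: vimage_def)
  also have "\<dots> = (\<Sum>i<l. (1/2) ^ Suc i)" by (subst measure_measure_pmf_finite) auto
  also have "\<dots> = 1 - (1/2) ^ l" by (induction l) auto
  finally have "measure_pmf.prob (cell_pmf m) {c. level c < l} = 1 - (1/2) ^ l" .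
  moreover have "{c. level c \<ge> l} = - {c. level c < l}" by auto
  ultimately show ?thesis using measure_pmf.prob_compl[of "{c. level c < l}" "cell_pmf m"]
    by (simp add: Compl_eq_Diff_UNIV)
qed

text \<open>The factor for the level is estimated by 1; what makes collisions rare is the uniform
  choice among \<open>m l\<close> positions.\<close>

lemma prob_level_pos:
  assumes "m l > 0"
  shows "measure_pmf.prob (cell_pmf m) {c. level c = l \<and> pos c = r} \<le> 1 / m l"
proof -
  have "map_pmf (\<lambda>c. (level c, pos c)) (cell_pmf m) =
      bind_pmf (geometric_pmf (1/2)) (\<lambda>l. map_pmf (Pair l) (map_pmf fst
        (pair_pmf (pmf_of_set {..<m l}) (pmf_of_set (Pow (Pow {..<m l}))))))"
    unfolding cell_pmf_def map_bind_pmf by (simp add: pmf.map_comp o_def)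
  then have "pmf (map_pmf (\<lambda>c. (level c, pos c)) (cell_pmf m)) (l, r) = (1/2) ^ Suc l * pmf (pmf_of_set {..<m l}) r"
    by (simp add: map_fst_pair_pmf pmf_bind_Pair)
  also have "pmf (pmf_of_set {..<m l}) r \<le> 1 / m l"
    using assms by (subst pmf_of_set) (auto simp: indicator_def)
  also have "(1/2) ^ Suc l * (1 / real (m l)) \<le> 1 * (1 / real (m l))"
    by (intro mult_right_mono power_le_one) auto
  finally show ?thesis by (simp add: pmf_map vimage_def)
qed

lemma prob_cells_pmf:
  assumes "J \<subseteq> {..<n}"
  shows "measure_pmf.prob (cells_pmf m n) {\<omega>. \<forall>v\<in>J. \<omega> v \<in> A} = measure_pmf.prob (cell_pmf m) A ^ card J"
proof -
  have "{\<omega>. \<forall>v\<in>J. \<omega> v \<in> A} = Pi {..<n} (\<lambda>v. if v \<in> J then A else UNIV)"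
    using assms by (auto simp: Pi_def split: if_splits)
  then have "measure_pmf.prob (cells_pmf m n) {\<omega>. \<forall>v\<in>J. \<omega> v \<in> A} =
      (\<Prod>v<n. measure_pmf.prob (cell_pmf m) (if v \<in> J then A else UNIV))"
    by (simp add: cells_pmf_def measure_Pi_pmf_Pi)
  also have "\<dots> = (\<Prod>v\<in>J. measure_pmf.prob (cell_pmf m) A)"
    using assms by (intro prod.mono_neutral_cong_right) auto
  finally show ?thesis by simp
qed

lemma set_cells_pmf:
  "\<omega> \<in> set_pmf (cells_pmf m n) \<Longrightarrow> v < n \<Longrightarrow> \<omega> v \<in> set_pmf (cell_pmf m)"
  by (auto simp: cells_pmf_def set_Pi_pmf PiE_dflt_def)

lemma finite_cell_structures: "finite (cell_structure k n ` A)"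
  by (rule finite_subset[of _ "Pow {a. set a \<subseteq> {..<n} \<and> length a = k}"])
     (auto simp: cell_structure_def finite_lists_length_eq)

text \<open>Distinct positions make the vertex of smallest position unique, so a single table
  decides the set.\<close>

lemma edge_owner:
  assumes lev: "\<And>u. u \<in> J \<Longrightarrow> level (\<omega> u) = l" and inj: "inj_on (\<lambda>u. pos (\<omega> u)) J"
    and v: "v \<in> J" "pos (\<omega> v) = Min ((\<lambda>u. pos (\<omega> u)) ` J)"
  shows "edge (\<omega> ` J) \<longleftrightarrow> (\<lambda>u. pos (\<omega> u)) ` J \<in> tab (\<omega> v)"
proof
  have p: "pos ` \<omega> ` J = (\<lambda>u. pos (\<omega> u)) ` J" by (rule image_image)
  {
    assume "edge (\<omega> ` J)"
    then obtain u where u: "u \<in> J" "pos (\<omega> u) = Min ((\<lambda>u. pos (\<omega> u)) ` J)"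
      "(\<lambda>u. pos (\<omega> u)) ` J \<in> tab (\<omega> u)"
      unfolding edge_def p by blast
    have "u = v" using inj_onD[OF inj, of u v] u(1,2) v by simp
    with u show "(\<lambda>u. pos (\<omega> u)) ` J \<in> tab (\<omega> v)" by simp
  next
    assume "(\<lambda>u. pos (\<omega> u)) ` J \<in> tab (\<omega> v)"
    moreover have "level ` \<omega> ` J = {l}" using lev v(1) by force
    ultimately show "edge (\<omega> ` J)" unfolding edge_def p using v by blast
  }
qed

text \<open>
  For \<open>k\<close>-sets \<open>J\<close> of vertices of level \<open>l\<close> with distinct positions, flipping the table entry that
  decides \<open>J\<close>, for all \<open>J \<in> h\<close> simultaneously, preserves the law of the cells and toggles exactly the
  edges in \<open>h\<close>. Hence all edge patterns on such vertices are equally likely.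
\<close>

definition keys :: "nat set set \<Rightarrow> (nat \<Rightarrow> cell) \<Rightarrow> nat \<Rightarrow> nat set set" where
  "keys h \<omega> v = {(\<lambda>u. pos (\<omega> u)) ` J | J. J \<in> h \<and> v \<in> J \<and> pos (\<omega> v) = Min ((\<lambda>u. pos (\<omega> u)) ` J)}"

definition flip :: "nat \<Rightarrow> nat \<Rightarrow> nat set set \<Rightarrow> (nat \<Rightarrow> cell) \<Rightarrow> nat \<Rightarrow> cell" where
  "flip M l h \<omega> v = (if level (\<omega> v) = l
     then (l, pos (\<omega> v), {X. (X \<in> tab (\<omega> v)) \<noteq> (X \<in> keys h \<omega> v \<and> X \<subseteq> {..<M})}) else \<omega> v)"

lemma level_flip [simp]: "level (flip M l h \<omega> v) = level (\<omega> v)"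
  and pos_flip [simp]: "pos (flip M l h \<omega> v) = pos (\<omega> v)"
  by (simp_all add: flip_def)

lemma flip_flip [simp]: "flip M l h (flip M l h \<omega>) = \<omega>"
proof
  fix v
  \<comment> \<open>Keys are computed from positions alone, so the second flip toggles the same
    entries as the first.\<close>
  have "keys h (flip M l h \<omega>) = keys h \<omega>" by (simp add: keys_def fun_eq_iff)
  then show "flip M l h (flip M l h \<omega>) v = \<omega> v"
    unfolding flip_def[of M l h "flip M l h \<omega>"] by (auto simp: flip_def prod_eq_iff)
qed

lemma edge_flip:
  assumes lev: "\<And>u. u \<in> S \<Longrightarrow> level (\<omega> u) = l" and lt: "\<And>u. u \<in> S \<Longrightarrow> pos (\<omega> u) < M"
    and inj: "inj_on (\<lambda>u. pos (\<omega> u)) S"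
    and J: "J \<subseteq> S" "finite J" "J \<noteq> {}" and h: "h \<subseteq> Pow S"
  shows "edge (flip M l h \<omega> ` J) \<longleftrightarrow> edge (\<omega> ` J) \<noteq> (J \<in> h)"
proof -
  let ?p = "\<lambda>u. pos (\<omega> u)"
  have "Min (?p ` J) \<in> ?p ` J" using J by (intro Min_in) auto
  then obtain v where v: "v \<in> J" "pos (\<omega> v) = Min (?p ` J)" by auto
  have injJ: "inj_on ?p J" using inj J(1) by (rule inj_on_subset)
  \<comment> \<open>Injectivity of the positions on \<open>S\<close> lets the key determine the set,
    so no other member of \<open>h\<close> toggles the entry that decides \<open>J\<close>.\<close>
  have key: "?p ` J \<in> keys h \<omega> v \<longleftrightarrow> J \<in> h"
  proof
    assume "?p ` J \<in> keys h \<omega> v"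
    then obtain J' where "J' \<in> h" "?p ` J = ?p ` J'" by (auto simp: keys_def)
    moreover from this have "J = J'" using inj_on_image_eq_iff[OF inj, of J J'] J(1) h by auto
    ultimately show "J \<in> h" by simp
  qed (use v in \<open>auto simp: keys_def\<close>)
  have "edge (flip M l h \<omega> ` J) \<longleftrightarrow> ?p ` J \<in> tab (flip M l h \<omega> v)"
    using edge_owner[of J "flip M l h \<omega>" l v] lev J(1) injJ v by auto
  also have "\<dots> \<longleftrightarrow> (?p ` J \<in> tab (\<omega> v)) \<noteq> (?p ` J \<in> keys h \<omega> v)"
    using lev J(1) v(1) lt by (auto simp: flip_def)
  also have "?p ` J \<in> tab (\<omega> v) \<longleftrightarrow> edge (\<omega> ` J)"
    using edge_owner[of J \<omega> l v] lev J(1) injJ v by auto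
  finally show ?thesis using key by simp
qed

text \<open>As \<open>flip\<close> is an involution, the pushed-forward mass at a point is the mass
  at its flip. This equals the original mass, since levels and positions stay and tables are
  uniform.\<close>

lemma map_flip_cells_pmf:
  assumes h: "h \<subseteq> Pow {..<n}"
  shows "map_pmf (flip (m l) l h) (cells_pmf m n) = cells_pmf m n"
proof (rule pmf_eqI)
  fix \<omega>
  let ?f = "flip (m l) l h"
  have "inj ?f" by (rule inj_on_inverseI[of _ ?f]) simp
  then have "pmf (map_pmf ?f (cells_pmf m n)) (?f (?f \<omega>)) = pmf (cells_pmf m n) (?f \<omega>)"
    by (rule pmf_map_inj')
  moreover have "pmf (cells_pmf m n) (?f \<omega>) = pmf (cells_pmf m n) \<omega>"
  proof -
    \<comment> \<open>Members of \<open>h\<close> contain no vertex outside \<open>{..<n}\<close>,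
      so the default value there survives the flip.\<close>
    have out: "?f \<omega> v = \<omega> v" if "v \<notin> {..<n}" for v
    proof -
      have "keys h \<omega> v = {}" using that h by (auto simp: keys_def)
      then show ?thesis by (auto simp: flip_def prod_eq_iff)
    qed
    have "pmf (cell_pmf m) (?f \<omega> v) = pmf (cell_pmf m) (\<omega> v)" for v
    proof (cases "level (\<omega> v) = l")
      case True
      obtain r B where \<omega>: "\<omega> v = (l, r, B)" using True by (cases "\<omega> v") auto
      define B' where "B' = {X. (X \<in> B) \<noteq> (X \<in> keys h \<omega> v \<and> X \<subseteq> {..<m l})}"
      have "?f \<omega> v = (l, r, B')" by (simp add: flip_def \<omega> B'_def)
      \<comment> \<open>Here the clause \<open>X \<subseteq> {..<M}\<close> of \<open>flip\<close>
        is used: a table stays inside the support, or outside it, even at points of mass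
        zero.\<close>
      moreover have "B' \<subseteq> Pow {..<m l} \<longleftrightarrow> B \<subseteq> Pow {..<m l}" by (auto simp: B'_def)
      moreover have "pmf (pmf_of_set (Pow (Pow {..<m l}))) X = (if X \<subseteq> Pow {..<m l} then 1 else 0) / card (Pow (Pow {..<m l}))"
        for X by (subst pmf_of_set) (auto simp: indicator_def)
      ultimately show ?thesis unfolding \<omega> by (simp only: pmf_cell_pmf)
    qed (simp add: flip_def)
    moreover have "(\<forall>v. v \<notin> {..<n} \<longrightarrow> ?f \<omega> v = undefined) \<longleftrightarrow> (\<forall>v. v \<notin> {..<n} \<longrightarrow> \<omega> v = undefined)"
      using out by metis
    ultimately show ?thesis by (simp only: cells_pmf_def pmf_Pi finite_lessThan)
  qed
  ultimately show "pmf (map_pmf ?f (cells_pmf m n)) \<omega> = pmf (cells_pmf m n) \<omega>" by simp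
qed

section \<open>Lower bound on the entropy\<close>

definition level_set :: "nat \<Rightarrow> nat \<Rightarrow> (nat \<Rightarrow> cell) \<Rightarrow> nat set" where
  "level_set n l \<omega> = {v. v < n \<and> level (\<omega> v) = l}"

text \<open>After a collision of positions the value is \<open>{}\<close>, which has no
  \<open>k\<close>-subsets for \<open>k > 0\<close>, so no entropy is claimed in that case. A
  nonempty value certifies distinct positions.\<close>

definition free_set :: "nat \<Rightarrow> nat \<Rightarrow> (nat \<Rightarrow> cell) \<Rightarrow> nat set" where
  "free_set n l \<omega> = (if inj_on (\<lambda>v. pos (\<omega> v)) (level_set n l \<omega>) then level_set n l \<omega> else {})"

lemma free_set_flip [simp]: "free_set n l (flip M l' h \<omega>) = free_set n l \<omega>"
  by (simp add: free_set_def level_set_def)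

text \<open>For each of the \<open>2 ^ card K\<close> sets \<open>h\<close> of
  \<open>k\<close>-subsets of \<open>S\<close>, pulling the event back along the flip preserves its
  probability. The pullbacks are disjoint, because different \<open>h\<close> toggle different
  edges, and all lie in the event that the free set is \<open>S\<close>.\<close>

lemma prob_cell_structure_free_set:
  assumes m: "\<And>l. m l > 0" and k: "k > 0"
  shows "measure_pmf.prob (cells_pmf m n) {\<omega>. cell_structure k n \<omega> = g \<and> free_set n l \<omega> = S} \<le>
    measure_pmf.prob (cells_pmf m n) {\<omega>. free_set n l \<omega> = S} * 2 powr (- real (card S choose k))"
proof (cases "S \<subseteq> {..<n}")
  case False
  then have "{\<omega>. cell_structure k n \<omega> = g \<and> free_set n l \<omega> = S} = {}" by (auto simp: free_set_def level_set_def split: if_splits)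
  then show ?thesis by (simp only: measure_empty) simp
next
  case True
  define K where "K = {J. J \<subseteq> S \<and> card J = k}"
  define E where "E = {\<omega>. cell_structure k n \<omega> = g \<and> free_set n l \<omega> = S}"
  \<comment> \<open>Intersecting with the support provides positions below \<open>m l\<close>, as
    \<open>edge_flip\<close> requires.\<close>
  define F where "F h = flip (m l) l h -` E \<inter> set_pmf (cells_pmf m n)" for h
  have finS: "finite S" using True finite_subset by blast
  then have finK: "finite K" by (simp add: K_def)
  have probF: "measure_pmf.prob (cells_pmf m n) (F h) = measure_pmf.prob (cells_pmf m n) E" if "h \<subseteq> K" for h
  proof -
    have "h \<subseteq> Pow {..<n}" using that True unfolding K_def by blast
    from map_flip_cells_pmf[OF this, of m l] have "measure_pmf.prob (cells_pmf m n) E =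
        measure_pmf.prob (map_pmf (flip (m l) l h) (cells_pmf m n)) E" by simp
    then show ?thesis by (simp add: F_def measure_Int_set_pmf)
  qed
  \<comment> \<open>A configuration in both events becomes \<open>g\<close> under either flip, so
    both flips toggle the same edges on \<open>S\<close>. Exchanging \<open>h\<close> and
    \<open>h'\<close> then gives equality.\<close>
  have sub: "h \<subseteq> h'" if h: "h \<subseteq> K" "h' \<subseteq> K" and \<omega>: "\<omega> \<in> F h" "\<omega> \<in> F h'" for h h' \<omega>
  proof
    fix J assume "J \<in> h"
    then have J: "J \<subseteq> S" "card J = k" using h by (auto simp: K_def)
    then have J': "finite J" "J \<noteq> {}" "S \<noteq> {}" using finite_subset[OF _ finS] k by auto
    have fS: "free_set n l \<omega> = S" using \<omega> by (auto simp: F_def E_def)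
    then have S: "S = level_set n l \<omega>" "inj_on (\<lambda>v. pos (\<omega> v)) S"
      using J'(3) by (auto simp: free_set_def split: if_splits)
    have lev: "level (\<omega> u) = l" "pos (\<omega> u) < m l" if "u \<in> S" for u
    proof -
      show 1: "level (\<omega> u) = l" using that S(1) by (auto simp: level_set_def)
      have "\<omega> u \<in> set_pmf (cell_pmf m)"
        using that True \<omega> by (intro set_cells_pmf[of \<omega> m n]) (auto simp: F_def)
      then show "pos (\<omega> u) < m l" using 1 by (auto simp: set_cell_pmf[OF m])
    qed
    have e: "edge (flip (m l) l h'' \<omega> ` J) \<longleftrightarrow> edge (\<omega> ` J) \<noteq> (J \<in> h'')" if "h'' \<subseteq> K" for h''
      by (rule edge_flip[OF lev S(2) J(1) J'(1,2)]) (use that in \<open>auto simp: K_def\<close>)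
    obtain a where a: "set a = J" "distinct a" using finite_distinct_list J'(1) by blast
    then have "length a = k" "set a \<subseteq> {..<n}" using J True distinct_card[of a] by auto
    then have "a \<in> cell_structure k n \<omega>' \<longleftrightarrow> edge (\<omega>' ` J)" for \<omega>' using a by (simp add: cell_structure_def)
    then have "edge (flip (m l) l h \<omega> ` J) \<longleftrightarrow> edge (flip (m l) l h' \<omega> ` J)"
      using \<omega> by (auto simp: F_def E_def)
    with e[OF h(1)] e[OF h(2)] \<open>J \<in> h\<close> show "J \<in> h'" by blast
  qed
  have "2 ^ card K * measure_pmf.prob (cells_pmf m n) E = (\<Sum>h\<in>Pow K. measure_pmf.prob (cells_pmf m n) (F h))"
    using probF by (simp add: card_Pow finK)
  also have "\<dots> = measure_pmf.prob (cells_pmf m n) (\<Union>h\<in>Pow K. F h)"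
  proof (rule measure_pmf.finite_measure_finite_Union[symmetric])
    show "disjoint_family_on F (Pow K)"
      unfolding disjoint_family_on_def
    proof (intro ballI impI equals0I)
      fix h h' \<omega> assume "h \<in> Pow K" "h' \<in> Pow K" "h \<noteq> h'" "\<omega> \<in> F h \<inter> F h'"
      then show False using sub[of h h' \<omega>] sub[of h' h \<omega>] by auto
    qed
  qed (use finK in auto)
  also have "\<dots> \<le> measure_pmf.prob (cells_pmf m n) {\<omega>. free_set n l \<omega> = S}"
    by (intro measure_pmf.finite_measure_mono) (auto simp: F_def E_def)
  finally have "2 ^ card K * measure_pmf.prob (cells_pmf m n) E \<le> measure_pmf.prob (cells_pmf m n) {\<omega>. free_set n l \<omega> = S}" .
  moreover have "card K = card S choose k" unfolding K_def by (rule n_subsets[OF finS])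
  ultimately show ?thesis by (simp add: E_def powr_minus powr_realpow divide_simps mult.commute)
qed

text \<open>Linearity of expectation, with the binomial coefficient written as a sum of indicators
  of \<open>k\<close>-subsets.\<close>

lemma expectation_binomial_subsets:
  fixes P :: "'w pmf" and S :: "'w \<Rightarrow> nat set"
  assumes "\<And>\<omega>. S \<omega> \<subseteq> {..<n}"
  shows "measure_pmf.expectation P (\<lambda>\<omega>. real (card (S \<omega>) choose k)) =
    (\<Sum>J\<in>{J. J \<subseteq> {..<n} \<and> card J = k}. measure_pmf.prob P {\<omega>. J \<subseteq> S \<omega>})"
proof -
  have fin: "finite {J. J \<subseteq> {..<n} \<and> card J = k}" by simp
  have "real (card (S \<omega>) choose k) = (\<Sum>J\<in>{J. J \<subseteq> {..<n} \<and> card J = k}. indicator {\<omega>. J \<subseteq> S \<omega>} \<omega>)" for \<omega>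
  proof -
    have "card (S \<omega>) choose k = card {J. J \<subseteq> S \<omega> \<and> card J = k}"
      using assms[of \<omega>] by (intro n_subsets[symmetric]) (rule finite_subset, auto)
    also have "real \<dots> = (\<Sum>J\<in>{J. J \<subseteq> S \<omega> \<and> card J = k}. 1)" by simp
    also have "\<dots> = (\<Sum>J\<in>{J. J \<subseteq> {..<n} \<and> card J = k}. indicator {\<omega>. J \<subseteq> S \<omega>} \<omega>)"
      using assms[of \<omega>] fin by (intro sum.mono_neutral_cong_left) (auto simp: indicator_def)
    finally show ?thesis .
  qed
  then have "measure_pmf.expectation P (\<lambda>\<omega>. real (card (S \<omega>) choose k)) =
    measure_pmf.expectation P (\<lambda>\<omega>. \<Sum>J\<in>{J. J \<subseteq> {..<n} \<and> card J = k}. indicator {\<omega>. J \<subseteq> S \<omega>} \<omega>)" by simp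
  also have "\<dots> = (\<Sum>J\<in>{J. J \<subseteq> {..<n} \<and> card J = k}. measure_pmf.expectation P (indicator {\<omega>. J \<subseteq> S \<omega>}))"
    by (rule Bochner_Integration.integral_sum) (auto intro!: integrable_real_indicator simp: measure_pmf.emeasure_eq_measure)
  finally show ?thesis by simp
qed

text \<open>Union bound over ordered pairs of vertices and a common position: at most
  \<open>n\<^sup>2 * m l\<close> events, each of probability at most
  \<open>(1 / m l)\<^sup>2\<close> by independence.\<close>

lemma prob_not_inj:
  assumes m: "\<And>l. m l > 0"
  shows "measure_pmf.prob (cells_pmf m n) {\<omega>. \<not> inj_on (\<lambda>v. pos (\<omega> v)) (level_set n l \<omega>)} \<le> (real n)\<^sup>2 / m l"
proof -
  let ?P = "cells_pmf m n"
  define I where "I = {(i, j). i < n \<and> j < n \<and> i \<noteq> j} \<times> {..<m l}"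
  define A where "A = (\<lambda>((i, j), r). {\<omega> :: nat \<Rightarrow> cell. \<forall>v\<in>{i, j}. \<omega> v \<in> {c. level c = l \<and> pos c = r}})"
  have finI: "finite I" unfolding I_def
    by (intro finite_cartesian_product finite_subset[of "{(i, j). i < n \<and> j < n \<and> i \<noteq> j}" "{..<n} \<times> {..<n}"]) auto
  have "measure_pmf.prob ?P {\<omega>. \<not> inj_on (\<lambda>v. pos (\<omega> v)) (level_set n l \<omega>)} =
      measure_pmf.prob ?P ({\<omega>. \<not> inj_on (\<lambda>v. pos (\<omega> v)) (level_set n l \<omega>)} \<inter> set_pmf ?P)"
    by (simp add: measure_Int_set_pmf)
  also have "\<dots> \<le> measure_pmf.prob ?P (\<Union>x\<in>I. A x)"
  proof (intro measure_pmf.finite_measure_mono subsetI)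
    fix \<omega> assume "\<omega> \<in> {\<omega>. \<not> inj_on (\<lambda>v. pos (\<omega> v)) (level_set n l \<omega>)} \<inter> set_pmf ?P"
    then obtain i j where ij: "i < n" "j < n" "i \<noteq> j" "level (\<omega> i) = l" "level (\<omega> j) = l"
      "pos (\<omega> i) = pos (\<omega> j)" "\<omega> \<in> set_pmf ?P" by (auto simp: inj_on_def level_set_def)
    then have "pos (\<omega> i) < m l"
      using set_cells_pmf[OF ij(7,1)] by (auto simp: set_cell_pmf[OF m])
    with ij have "((i, j), pos (\<omega> i)) \<in> I" "\<omega> \<in> A ((i, j), pos (\<omega> i))" by (auto simp: I_def A_def)
    then show "\<omega> \<in> (\<Union>x\<in>I. A x)" by blast
  qed auto
  also have "\<dots> \<le> (\<Sum>x\<in>I. measure_pmf.prob ?P (A x))"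
    by (intro measure_pmf.finite_measure_subadditive_finite finI) auto
  also have "\<dots> \<le> (\<Sum>x\<in>I. (1 / m l)\<^sup>2)"
  proof (rule sum_mono)
    fix x assume "x \<in> I"
    then obtain i j r where x: "x = ((i, j), r)" "i < n" "j < n" "i \<noteq> j" by (auto simp: I_def)
    then have "measure_pmf.prob ?P (A x) = measure_pmf.prob (cell_pmf m) {c. level c = l \<and> pos c = r} ^ card {i, j}"
      unfolding A_def x(1) prod.case by (intro prob_cells_pmf) auto
    also have "\<dots> = measure_pmf.prob (cell_pmf m) {c. level c = l \<and> pos c = r} ^ 2"
      using x by (simp add: numeral_2_eq_2)
    also have "\<dots> \<le> (1 / m l)\<^sup>2"
      by (intro power_mono prob_level_pos m) simp
    finally show "measure_pmf.prob ?P (A x) \<le> (1 / m l)\<^sup>2" .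
  qed
  also have "\<dots> = card I * (1 / m l)\<^sup>2" by simp
  also have "\<dots> \<le> (n\<^sup>2 * m l) * (1 / m l)\<^sup>2"
  proof -
    have "card I \<le> card (({..<n} \<times> {..<n}) \<times> {..<m l})"
      by (intro card_mono) (auto simp: I_def)
    then have "card I \<le> n\<^sup>2 * m l" by (simp add: card_cartesian_product power2_eq_square)
    then have "real (card I) \<le> real (n\<^sup>2 * m l)" by (rule of_nat_mono)
    then show ?thesis by (intro mult_right_mono) auto
  qed
  also have "\<dots> = (real n)\<^sup>2 / m l" using m[of l] by (simp add: power2_eq_square field_simps)
  finally show ?thesis .
qed

text \<open>The expected number of \<open>k\<close>-subsets of the free set bounds the entropy from
  below. A \<open>k\<close>-set lies in level \<open>l\<close> with probability
  \<open>(1/2) ^ (Suc l * k)\<close>, and \<open>large\<close> keeps the collision probability to at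
  most half of that.\<close>

lemma entropy_cell_structure_ge:
  assumes m: "\<And>l. m l > 0" and k: "k > 0"
    and large: "2 * (real n)\<^sup>2 * 2 ^ (Suc l * k) \<le> m l"
  shows "real (n choose k) * (1/2) ^ (Suc l * k) / 2 \<le> pmf_entropy (map_pmf (cell_structure k n) (cells_pmf m n))"
proof -
  let ?P = "cells_pmf m n"
  let ?K = "{J. J \<subseteq> {..<n} \<and> card J = k}"
  let ?bad = "{\<omega>. \<not> inj_on (\<lambda>v. pos (\<omega> v)) (level_set n l \<omega>)}"
  have sub: "free_set n l \<omega> \<subseteq> {..<n}" for \<omega> by (auto simp: free_set_def level_set_def)
  have bad: "measure_pmf.prob ?P ?bad \<le> (1/2) ^ (Suc l * k) / 2"
  proof -
    have "(real n)\<^sup>2 / m l \<le> (1/2) ^ (Suc l * k) / 2"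
    proof -
      have "2 * (real n)\<^sup>2 = 2 * (real n)\<^sup>2 * 2 ^ (Suc l * k) * (1/2) ^ (Suc l * k)"
        by (simp add: mult.assoc flip: power_mult_distrib)
      also have "\<dots> \<le> m l * (1/2) ^ (Suc l * k)"
        using large by (intro mult_right_mono) auto
      finally show ?thesis using m[of l] by (simp add: field_simps)
    qed
    then show ?thesis using prob_not_inj[of m n l, OF m] by linarith
  qed
  have "real (n choose k) * (1/2) ^ (Suc l * k) / 2 = (\<Sum>J\<in>?K. (1/2) ^ (Suc l * k) / 2)"
    using n_subsets[of "{..<n}" k] by simp
  also have "\<dots> \<le> (\<Sum>J\<in>?K. measure_pmf.prob ?P {\<omega>. J \<subseteq> free_set n l \<omega>})"
  proof (rule sum_mono)
    fix J assume J: "J \<in> ?K"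
    have "(1/2) ^ (Suc l * k) = measure_pmf.prob ?P {\<omega>. \<forall>v\<in>J. \<omega> v \<in> {c. level c = l}}"
      using J by (subst prob_cells_pmf) (auto simp: prob_level power_mult simp del: mult_Suc power_Suc)
    also have "\<dots> \<le> measure_pmf.prob ?P ({\<omega>. J \<subseteq> free_set n l \<omega>} \<union> ?bad)"
      using J by (intro measure_pmf.finite_measure_mono) (auto simp: free_set_def level_set_def)
    also have "\<dots> \<le> measure_pmf.prob ?P {\<omega>. J \<subseteq> free_set n l \<omega>} + measure_pmf.prob ?P ?bad"
      by (intro measure_subadditive) auto
    finally show "(1/2) ^ (Suc l * k) / 2 \<le> measure_pmf.prob ?P {\<omega>. J \<subseteq> free_set n l \<omega>}"
      using bad by linarith
  qed
  also have "\<dots> = measure_pmf.expectation ?P (\<lambda>\<omega>. real (card (free_set n l \<omega>) choose k))"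
    by (rule expectation_binomial_subsets[OF sub, symmetric])
  also have "\<dots> \<le> pmf_entropy (map_pmf (cell_structure k n) ?P)"
  proof (rule pmf_entropy_map_ge[where c = "free_set n l" and s = "\<lambda>S. real (card S choose k)"])
    show "finite (free_set n l ` set_pmf ?P)"
      by (rule finite_subset[of _ "Pow {..<n}"]) (use sub in auto)
  qed (use finite_cell_structures prob_cell_structure_free_set[OF m k] in auto)
  finally show ?thesis .
qed

text \<open>
  For the upper bound, the cells of level below \<open>l\<close> are revealed; since all vertices of an edge
  have the same level, only \<open>k\<close>-sets of vertices of level at least \<open>l\<close> remain undecided.
\<close>

definition small_cells :: "(nat \<Rightarrow> nat) \<Rightarrow> nat \<Rightarrow> cell set" where
  "small_cells m l = {c \<in> set_pmf (cell_pmf m). level c < l}"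

lemma finite_small_cells:
  assumes m: "\<And>l. m l > 0"
  shows "finite (small_cells m l)"
proof -
  have "small_cells m l \<subseteq> (SIGMA i:{..<l}. {..<m i} \<times> Pow (Pow {..<m i}))"
    by (auto simp: small_cells_def set_cell_pmf[OF m])
  then show ?thesis by (rule finite_subset) auto
qed

lemma entropy_cell_structure_le:
  assumes m: "\<And>l. m l > 0" and k: "k > 0"
  shows "pmf_entropy (map_pmf (cell_structure k n) (cells_pmf m n)) \<le>
    real n * log 2 (Suc (card (small_cells m l))) + real n ^ k * (1/2) ^ l"
proof -
  let ?P = "cells_pmf m n"
  \<comment> \<open>\<open>None\<close> stands for a cell that stays hidden because its level is at
    least \<open>l\<close>.\<close>
  define C where "C = {..<n} \<rightarrow>\<^sub>E insert None (Some ` small_cells m l)"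
  define Y where "Y \<omega> = (\<lambda>v\<in>{..<n}. if level (\<omega> v) < l then Some (\<omega> v) else None)" for \<omega> :: "nat \<Rightarrow> cell"
  define big where "big y = {v. v < n \<and> y v = None}" for y :: "nat \<Rightarrow> cell option"
  define t where "t y = real (card (big y) choose k)" for y
  have finC: "finite C" unfolding C_def using finite_small_cells[OF m] by (intro finite_PiE) auto
  have "pmf_entropy (map_pmf (cell_structure k n) ?P) \<le> log 2 (card C) + measure_pmf.expectation ?P (\<lambda>\<omega>. t (Y \<omega>))"
  proof (rule pmf_entropy_map_le[OF finite_cell_structures finC])
    show "Y ` set_pmf ?P \<subseteq> C"
      unfolding Y_def C_def by (intro image_subsetI restrict_PiE_iff[THEN iffD2]) (auto simp: small_cells_def set_cells_pmf)
    fix y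
    define K where "K = {J. J \<subseteq> big y \<and> card J = k}"
    define \<Phi> where "\<Phi> g = K \<inter> set ` g" for g :: "nat list set"
    have fin: "finite (big y)" by (simp add: big_def)
    then have finK: "finite K" by (simp add: K_def)
    \<comment> \<open>Given the revealed cells \<open>y\<close>, the structure is determined by its
      edges among the hidden vertices, which \<open>\<Phi>\<close> records as sets.\<close>
    have le: "cell_structure k n \<omega> \<subseteq> cell_structure k n \<omega>'"
      if Y: "Y \<omega> = y" "Y \<omega>' = y" and eq: "\<Phi> (cell_structure k n \<omega>) = \<Phi> (cell_structure k n \<omega>')" for \<omega> \<omega>'
    proof
      fix a assume a: "a \<in> cell_structure k n \<omega>"
      then have a': "length a = k" "distinct a" "set a \<subseteq> {..<n}" "edge (\<omega> ` set a)" by (auto simp: cell_structure_def)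
      have "edge (\<omega>' ` set a)"
      proof (cases "set a \<subseteq> big y")
        case True
        then have "set a \<in> \<Phi> (cell_structure k n \<omega>)"
          using a a' by (auto simp: \<Phi>_def K_def distinct_card)
        then obtain b where "b \<in> cell_structure k n \<omega>'" "set a = set b" unfolding eq by (auto simp: \<Phi>_def)
        then show ?thesis by (auto simp: cell_structure_def)
      next
        case False
        \<comment> \<open>One revealed vertex puts the common level of the edge below
          \<open>l\<close>; hence all its cells are revealed and agree in both
          configurations.\<close>
        then obtain v where v: "v \<in> set a" "level (\<omega> v) < l"
          using a'(3) unfolding Y(1)[symmetric] by (fastforce simp: big_def Y_def split: if_splits)
        obtain i where "level ` \<omega> ` set a = {i}" using a'(4) by (auto simp: edge_def)
        then have "level (\<omega> u) = i" if "u \<in> set a" for u using that by (auto simp: image_image)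
        then have lt: "level (\<omega> u) < l" if "u \<in> set a" for u using that v by simp
        have "\<omega> u = \<omega>' u" if "u \<in> set a" for u
        proof -
          have "Y \<omega> u = Y \<omega>' u" using Y by simp
          then show ?thesis using lt[OF that] a'(3) that by (auto simp: Y_def split: if_splits)
        qed
        then have "\<omega> ` set a = \<omega>' ` set a" by (rule image_cong[OF refl])
        then show ?thesis using a'(4) by simp
      qed
      then show "a \<in> cell_structure k n \<omega>'" using a' by (simp add: cell_structure_def)
    qed
    have "inj_on \<Phi> (cell_structure k n ` {\<omega> \<in> set_pmf ?P. Y \<omega> = y})"
    proof (rule inj_onI, elim imageE CollectE conjE)
      fix g g' \<omega> \<omega>'
      assume *: "\<Phi> g = \<Phi> g'" "g = cell_structure k n \<omega>" "g' = cell_structure k n \<omega>'" "Y \<omega> = y" "Y \<omega>' = y"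
      show "g = g'" using le[of \<omega> \<omega>'] le[of \<omega>' \<omega>] * by simp
    qed
    then have "card (cell_structure k n ` {\<omega> \<in> set_pmf ?P. Y \<omega> = y}) \<le> card (Pow K)"
      by (rule card_inj_on_le) (auto simp: \<Phi>_def finK)
    also have "\<dots> = 2 ^ (card (big y) choose k)"
      using n_subsets[OF fin, of k] by (simp add: card_Pow[OF finK]) (simp add: K_def)
    finally have "real (card (cell_structure k n ` {\<omega> \<in> set_pmf ?P. Y \<omega> = y})) \<le> real (2 ^ (card (big y) choose k))"
      by (rule of_nat_mono)
    then show "real (card (cell_structure k n ` {\<omega> \<in> set_pmf ?P. Y \<omega> = y})) \<le> 2 powr t y"
      by (simp add: t_def powr_realpow)
  qed
  also have "log 2 (card C) = real n * log 2 (Suc (card (small_cells m l)))"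
    using finite_small_cells[OF m] by (simp add: C_def card_PiE card_image log_nat_power)
  also have "measure_pmf.expectation ?P (\<lambda>\<omega>. t (Y \<omega>)) =
      (\<Sum>J\<in>{J. J \<subseteq> {..<n} \<and> card J = k}. measure_pmf.prob ?P {\<omega>. J \<subseteq> big (Y \<omega>)})"
    unfolding t_def by (rule expectation_binomial_subsets) (auto simp: big_def)
  also have "\<dots> \<le> (\<Sum>J\<in>{J. J \<subseteq> {..<n} \<and> card J = k}. (1/2) ^ l)"
  proof (rule sum_mono)
    fix J assume J: "J \<in> {J. J \<subseteq> {..<n} \<and> card J = k}"
    then have "J \<noteq> {}" using k by auto
    then obtain v where "v \<in> J" by blast
    with J have v: "v \<in> J" "v < n" by auto
    \<comment> \<open>A single vertex suffices: if all of \<open>J\<close> is hidden, then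
      \<open>v\<close> has level at least \<open>l\<close>.\<close>
    then have "measure_pmf.prob ?P {\<omega>. J \<subseteq> big (Y \<omega>)} \<le> measure_pmf.prob ?P {\<omega>. \<forall>v\<in>{v}. \<omega> v \<in> {c. level c \<ge> l}}"
      by (intro measure_pmf.finite_measure_mono) (auto simp: big_def Y_def not_less split: if_splits)
    also have "\<dots> = (1/2) ^ l" using v by (subst prob_cells_pmf) (auto simp: prob_level_ge)
    finally show "measure_pmf.prob ?P {\<omega>. J \<subseteq> big (Y \<omega>)} \<le> (1/2) ^ l" .
  qed
  also have "\<dots> = real (n choose k) * (1/2) ^ l" using n_subsets[of "{..<n}" k] by simp
  also have "\<dots> \<le> real n ^ k * (1/2) ^ l"
  proof -
    have "n choose k \<le> n ^ k" by (cases "k \<le> n") (auto intro: binomial_le_pow simp: binomial_eq_0)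
    then show ?thesis by (intro mult_right_mono) (auto simp flip: of_nat_power)
  qed
  finally show ?thesis by simp
qed

text \<open>Fixing \<open>l\<close> first makes the undecided sets cost at most half of
  \<open>c * real n ^ k\<close>. The revealed cells then cost a constant multiple of
  \<open>n\<close>, which is negligible as \<open>k \<ge> 2\<close>.\<close>

lemma entropy_cell_structure_smallo:
  assumes m: "\<And>l. m l > 0" and k: "k \<ge> 2"
  shows "(\<lambda>n. pmf_entropy (map_pmf (cell_structure k n) (cells_pmf m n))) \<in> o(\<lambda>n. real n ^ k)"
proof (rule landau_o.smallI)
  fix c :: real assume c: "c > 0"
  obtain l where l: "(1/2) ^ l < c / 2" using real_arch_pow_inv[of "c/2" "1/2::real"] c by auto
  define A where "A = log 2 (Suc (card (small_cells m l)))"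
  have "\<forall>\<^sub>F n in sequentially. real n \<ge> max 1 (2 * A / c)"
    using filterlim_real_sequentially unfolding filterlim_at_top by blast
  then show "\<forall>\<^sub>F n in sequentially. norm (pmf_entropy (map_pmf (cell_structure k n) (cells_pmf m n))) \<le> c * norm (real n ^ k)"
  proof eventually_elim
    case (elim n)
    then have n: "real n \<ge> 1" "A \<le> c / 2 * real n" using c by (auto simp: field_simps)
    have "real n * A \<le> real n * (c / 2 * real n)" using n by (intro mult_left_mono) auto
    also have "\<dots> = c / 2 * real n ^ 2" by (simp add: power2_eq_square)
    also have "\<dots> \<le> c / 2 * real n ^ k"
      using n(1) k c by (intro mult_left_mono power_increasing) auto
    finally have 1: "real n * A \<le> c / 2 * real n ^ k" .
    have 2: "real n ^ k * (1/2) ^ l \<le> real n ^ k * (c / 2)" using l by (intro mult_left_mono) auto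
    have "pmf_entropy (map_pmf (cell_structure k n) (cells_pmf m n)) \<le> real n * A + real n ^ k * (1/2) ^ l"
      unfolding A_def using k by (intro entropy_cell_structure_le m) auto
    also have "\<dots> \<le> c / 2 * real n ^ k + real n ^ k * (c / 2)" using 1 2 by (rule add_mono)
    finally show ?case by (simp add: pmf_entropy_nonneg)
  qed
qed

section \<open>Transport from the unit interval\<close>

lemma prob_space_unif: "prob_space unif"
  by (rule prob_spaceI) (simp add: space_restrict_space emeasure_restrict_space)

text \<open>Quantile transform: the generalized inverse \<open>M.I\<close> of the distribution
  function carries the uniform law to the law of \<open>real\<close> under \<open>p\<close>, and
  rounding down returns to the naturals.\<close>

lemma ex_unif_pmf_nat:
  fixes p :: "nat pmf"
  shows "\<exists>f. f \<in> unif \<rightarrow>\<^sub>M count_space UNIV \<and> distr unif (count_space UNIV) f = measure_pmf p"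
proof -
  define M where "M = distr (measure_pmf p) borel real"
  interpret M: cdf_distribution M
    unfolding cdf_distribution_def M_def
    by (intro real_distribution.intro real_distribution_axioms.intro measure_pmf.prob_space_distr) auto
  \<comment> \<open>Inside the unit interval the default 0 concerns only the two endpoints, a null
    set.\<close>
  define g where "g = (\<lambda>x. if x \<in> {0<..<1} then M.I x else 0)"
  have [measurable]: "g \<in> borel_measurable borel"
    using M.measurable_CI unfolding g_def
    by (subst (asm) measurable_restrict_space_iff[where c = 0]) auto
  have g': "g \<in> unif \<rightarrow>\<^sub>M borel" by (rule measurable_restrict_space1) simp
  define h where "h x = nat \<lfloor>x\<rfloor>" for x :: real
  have [measurable]: "h \<in> borel \<rightarrow>\<^sub>M count_space UNIV" unfolding h_def by measurable
  have "distr unif borel g = distr (restrict_space lborel {0<..<1::real}) borel M.I"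
  proof (rule measure_eqI)
    fix A assume "A \<in> sets (distr unif borel g)"
    then have A [measurable]: "A \<in> sets borel" by simp
    have I: "M.I \<in> restrict_space lborel {0<..<1} \<rightarrow>\<^sub>M borel"
      using M.measurable_CI by (simp cong: measurable_cong_sets sets_restrict_space_cong)
    have 1: "M.I -` A \<inter> {0<..<1} = g -` A \<inter> {0<..<1}" by (auto simp: g_def)
    have "emeasure (distr unif borel g) A = emeasure lborel (g -` A \<inter> {0..1})"
      using g' by (simp add: emeasure_distr emeasure_restrict_space space_restrict_space)
    also have "\<dots> = emeasure lborel (g -` A \<inter> {0<..<1})"
    proof (rule emeasure_eq_AE)
      show "AE x in lborel. x \<in> g -` A \<inter> {0..1} \<longleftrightarrow> x \<in> g -` A \<inter> {0<..<1}"
        using AE_lborel_singleton[of "0::real"] AE_lborel_singleton[of "1::real"]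
        by eventually_elim auto
    qed (use measurable_sets_borel[of g borel A] in auto)
    also have "\<dots> = emeasure (distr (restrict_space lborel {0<..<1::real}) borel M.I) A"
      using I by (simp add: emeasure_distr emeasure_restrict_space space_restrict_space 1)
    finally show "emeasure (distr unif borel g) A = \<dots>" .
  qed simp
  then have g: "distr unif borel g = M" using M.distr_I_eq_M by simp
  have "distr unif (count_space UNIV) (h \<circ> g) = distr (distr unif borel g) (count_space UNIV) h"
    using g' by (subst distr_distr) auto
  also have "\<dots> = distr (measure_pmf p) (count_space UNIV) (h \<circ> real)"
    unfolding g M_def by (subst distr_distr) auto
  also have "h \<circ> real = id" by (auto simp: h_def)
  also have "distr (measure_pmf p) (count_space UNIV) id = measure_pmf p"
    unfolding id_def by (rule distr_id2) simp
  finally have "distr unif (count_space UNIV) (h \<circ> g) = measure_pmf p" .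
  moreover have "h \<circ> g \<in> unif \<rightarrow>\<^sub>M count_space UNIV" using g' by simp
  ultimately show ?thesis by blast
qed

text \<open>The countable support is numbered by naturals. Decoding with
  \<open>from_nat_into\<close> keeps every value in the support, not just almost every one.\<close>

lemma ex_unif_pmf:
  fixes p :: "'a pmf"
  shows "\<exists>f. f \<in> unif \<rightarrow>\<^sub>M count_space (set_pmf p) \<and> distr unif (count_space UNIV) f = measure_pmf p"
proof -
  let ?S = "set_pmf p"
  define e where "e = to_nat_on ?S"
  define d where "d = from_nat_into ?S"
  obtain f where f: "f \<in> unif \<rightarrow>\<^sub>M count_space UNIV"
    "distr unif (count_space UNIV) f = measure_pmf (map_pmf e p)"
    using ex_unif_pmf_nat by blast
  have "d \<in> count_space UNIV \<rightarrow>\<^sub>M count_space ?S"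
    by (auto simp: d_def from_nat_into set_pmf_not_empty)
  then have "d \<circ> f \<in> unif \<rightarrow>\<^sub>M count_space ?S" using f(1) by (rule measurable_comp[rotated])
  moreover have "distr unif (count_space UNIV) (d \<circ> f) = measure_pmf p"
  proof -
    have "distr unif (count_space UNIV) (d \<circ> f) = distr (distr unif (count_space UNIV) f) (count_space UNIV) d"
      using f(1) by (subst distr_distr) auto
    also have "\<dots> = measure_pmf (map_pmf d (map_pmf e p))" by (simp only: f(2) map_pmf_rep_eq)
    also have "map_pmf d (map_pmf e p) = map_pmf id p"
      unfolding pmf.map_comp by (intro map_pmf_cong) (auto simp: d_def e_def)
    finally show ?thesis by (simp add: o_def)
  qed
  ultimately show ?thesis by blast
qed

section \<open>The hypergraphon\<close>

lemma holds_map_literal: "holds M w (map_literal \<sigma> l) \<longleftrightarrow> holds M (w \<circ> \<sigma>) l"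
proof (cases l)
  case (Pos a) then show ?thesis by (cases a) auto
next
  case (Neg a) then show ?thesis by (cases a) auto
qed

lemma map_literal_in_literals:
  assumes "\<sigma> permutes {..<k}" "l \<in> literals k"
  shows "map_literal \<sigma> l \<in> literals k"
proof -
  have "\<sigma> i < k \<longleftrightarrow> i < k" for i using permutes_in_image[OF assms(1), of i] by simp
  then show ?thesis using assms(2)
    by (cases l; cases "case l of Pos a \<Rightarrow> a | Neg a \<Rightarrow> a") auto
qed

lemma type_act_qftp:
  assumes \<sigma>: "\<sigma> permutes {..<k}"
  shows "type_act \<sigma> (qftp k M v) = qftp k M (v \<circ> inv \<sigma>)"
proof (intro equalityI subsetI)
  fix l assume "l \<in> type_act \<sigma> (qftp k M v)"
  then show "l \<in> qftp k M (v \<circ> inv \<sigma>)"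
    using permutes_inv_o(2)[OF \<sigma>]
    by (auto simp: qftp_def holds_map_literal map_literal_in_literals[OF \<sigma>] comp_assoc)
next
  fix l assume l: "l \<in> qftp k M (v \<circ> inv \<sigma>)"
  have "l = map_literal \<sigma> (map_literal (inv \<sigma>) l)"
    by (simp add: literal.map_comp permutes_inv_o(1)[OF \<sigma>] literal.map_id)
  moreover have "map_literal (inv \<sigma>) l \<in> qftp k M v"
    using l by (simp add: qftp_def holds_map_literal map_literal_in_literals[OF permutes_inv[OF \<sigma>]])
  ultimately show "l \<in> type_act \<sigma> (qftp k M v)" by blast
qed

lemma type_act_qf_nr:
  assumes \<sigma>: "\<sigma> permutes {..<k}" and u: "u \<in> qf_nr k"
  shows "type_act \<sigma> u \<in> qf_nr k"
proof -
  obtain M v where M: "M \<in> structures k (UNIV :: nat set)" "inj_on v {..<k}" "u = qftp k M v"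
    using u by (auto simp: qf_nr_iff)
  have "inj_on (v \<circ> inv \<sigma>) {..<k}"
    using M(2) permutes_inv[OF \<sigma>] by (intro comp_inj_on) (auto simp: permutes_image permutes_inj_on)
  with M show ?thesis unfolding qf_nr_iff by (auto simp: type_act_qftp[OF \<sigma>])
qed

lemma type_top: "type_top k \<in> qf_nr k" "\<sigma> permutes {..<k} \<Longrightarrow> Pos (Rel (map \<sigma> [0..<k])) \<in> type_top k"
  using theI'[OF type_top_unique[of k]] by (auto simp: type_top_def)

lemma type_bot: "type_bot k \<in> qf_nr k" "\<sigma> permutes {..<k} \<Longrightarrow> Neg (Rel (map \<sigma> [0..<k])) \<in> type_bot k"
  using theI'[OF type_bot_unique[of k]] by (auto simp: type_bot_def)

text \<open>The property that singles out \<open>type_top k\<close> is invariant under renaming, so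
  uniqueness forces the type to be fixed.\<close>

lemma type_act_top:
  assumes \<sigma>: "\<sigma> permutes {..<k}"
  shows "type_act \<sigma> (type_top k) = type_top k"
proof -
  have "Pos (Rel (map \<tau> [0..<k])) \<in> type_act \<sigma> (type_top k)" if "\<tau> permutes {..<k}" for \<tau>
  proof (rule image_eqI)
    show "Pos (Rel (map (inv \<sigma> \<circ> \<tau>) [0..<k])) \<in> type_top k"
      by (intro type_top permutes_compose permutes_inv that \<sigma>)
  qed (simp add: permutes_inverses[OF \<sigma>])
  then show ?thesis
    using type_act_qf_nr[OF \<sigma> type_top(1)] type_top type_top_unique[of k] by blast
qed

lemma type_act_bot:
  assumes \<sigma>: "\<sigma> permutes {..<k}"
  shows "type_act \<sigma> (type_bot k) = type_bot k"
proof -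
  have "Neg (Rel (map \<tau> [0..<k])) \<in> type_act \<sigma> (type_bot k)" if "\<tau> permutes {..<k}" for \<tau>
  proof (rule image_eqI)
    show "Neg (Rel (map (inv \<sigma> \<circ> \<tau>) [0..<k])) \<in> type_bot k"
      by (intro type_bot permutes_compose permutes_inv that \<sigma>)
  qed (simp add: permutes_inverses[OF \<sigma>])
  then show ?thesis
    using type_act_qf_nr[OF \<sigma> type_bot(1)] type_bot type_bot_unique[of k] by blast
qed

lemma Rel_in_type_top:
  assumes "length is = k" "set is \<subseteq> {..<k}" "distinct is"
  shows "Pos (Rel is) \<in> type_top k"
  using distinct_list_permutes[OF assms] type_top(2) by metis

lemma Rel_notin_type_bot:
  assumes "length is = k" "set is \<subseteq> {..<k}" "distinct is"
  shows "Pos (Rel is) \<notin> type_bot k"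
proof -
  have "Neg (Rel is) \<in> type_bot k" using distinct_list_permutes[OF assms] type_bot(2) by metis
  then show ?thesis using type_bot(1)[of k] by (auto simp: qf_nr_iff qftp_def)
qed

definition cell_type :: "nat \<Rightarrow> (real \<Rightarrow> cell) \<Rightarrow> (nat set \<Rightarrow> real) \<Rightarrow> nat literal set" where
  "cell_type k q x = (if edge ((\<lambda>i. q (x {i})) ` {..<k}) then type_top k else type_bot k)"

definition cell_hypergraphon :: "nat \<Rightarrow> (real \<Rightarrow> cell) \<Rightarrow> hypergraphon" where
  "cell_hypergraphon k q x = return (qf_space k) (cell_type k q x)"

lemma cell_type_in: "cell_type k q x \<in> qf_nr k"
  by (simp add: cell_type_def type_top type_bot)

text \<open>A finite product of countable discrete spaces is discrete, so every map out of it is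
  measurable.\<close>

lemma measurable_finite_family:
  assumes "finite I" "countable C" "\<And>i. i \<in> I \<Longrightarrow> f i \<in> M \<rightarrow>\<^sub>M count_space C"
    and "\<And>h. h \<in> PiE I (\<lambda>_. C) \<Longrightarrow> g h \<in> X"
  shows "(\<lambda>x. g (\<lambda>i\<in>I. f i x)) \<in> M \<rightarrow>\<^sub>M count_space X"
proof (rule measurable_compose[where g = g])
  show "(\<lambda>x. \<lambda>i\<in>I. f i x) \<in> M \<rightarrow>\<^sub>M PiM I (\<lambda>_. count_space C)"
    by (rule measurable_restrict) (rule assms(3))
  show "g \<in> PiM I (\<lambda>_. count_space C) \<rightarrow>\<^sub>M count_space X"
    unfolding count_space_PiM_finite[OF assms(1,2)] using assms(4) by auto
qed

lemma measurable_cell_type: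
  assumes q: "q \<in> unif \<rightarrow>\<^sub>M count_space C" and C: "countable C" and k: "k \<ge> 2"
  shows "cell_type k q \<in> cube (P_lt k {..<k}) \<rightarrow>\<^sub>M qf_space k"
proof -
  have "(\<lambda>x. (\<lambda>h. if edge (h ` {..<k}) then type_top k else type_bot k) (\<lambda>i\<in>{..<k}. q (x {i})))
      \<in> cube (P_lt k {..<k}) \<rightarrow>\<^sub>M qf_space k"
  proof (rule measurable_finite_family[OF _ C])
    fix i assume "i \<in> {..<k}"
    then have "{i} \<in> P_lt k {..<k}" using k by auto
    then show "(\<lambda>x. q (x {i})) \<in> cube (P_lt k {..<k}) \<rightarrow>\<^sub>M count_space C"
      by (intro measurable_compose[OF _ q] measurable_component_singleton)
  qed (auto simp: type_top type_bot)
  moreover have "(\<lambda>i\<in>{..<k}. q (x {i})) ` {..<k} = (\<lambda>i. q (x {i})) ` {..<k}" for x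
    by (rule image_cong) auto
  ultimately show ?thesis by (simp only: cell_type_def[abs_def])
qed

text \<open>Only the set of cells at the singletons enters, and permuting coordinates preserves it;
  the two possible types are themselves fixed by permutations. Singletons are coordinates because
  \<open>k \<ge> 2\<close>.\<close>

lemma ext_hypergraphon_cell:
  assumes q: "q \<in> unif \<rightarrow>\<^sub>M count_space C" and C: "countable C" and k: "k \<ge> 2"
  shows "ext_hypergraphon k (cell_hypergraphon k q)"
  unfolding ext_hypergraphon_def
proof (intro conjI allI impI ballI)
  show "cell_hypergraphon k q \<in> cube (P_lt k {..<k}) \<rightarrow>\<^sub>M prob_algebra (qf_space k)"
    unfolding cell_hypergraphon_def
    by (rule measurable_compose[OF measurable_cell_type[OF q C k] measurable_return_prob_space])
next
  fix \<sigma> x assume \<sigma>: "\<sigma> permutes {..<k}" and x: "x \<in> space (cube (P_lt k {..<k}))"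
  define y where "y = (\<lambda>F \<in> P_lt k {..<k}. x (\<sigma> ` F))"
  have "y {i} = x {\<sigma> i}" if "i < k" for i using that k by (simp add: y_def)
  then have "(\<lambda>i. q (y {i})) ` {..<k} = (\<lambda>i. q (x {i})) ` \<sigma> ` {..<k}"
    by (simp add: image_image)
  also have "\<sigma> ` {..<k} = {..<k}" by (rule permutes_image[OF \<sigma>])
  finally have y: "cell_type k q y = cell_type k q x" by (simp add: cell_type_def)
  have "type_act \<sigma> \<in> qf_space k \<rightarrow>\<^sub>M qf_space k" using type_act_qf_nr[OF \<sigma>] by auto
  then have "distr (cell_hypergraphon k q x) (qf_space k) (type_act \<sigma>) =
      return (qf_space k) (type_act \<sigma> (cell_type k q x))"
    unfolding cell_hypergraphon_def by (rule distr_return) (simp add: cell_type_in)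
  also have "type_act \<sigma> (cell_type k q x) = cell_type k q x"
    by (simp add: cell_type_def type_act_top[OF \<sigma>] type_act_bot[OF \<sigma>])
  finally show "cell_hypergraphon k q y = distr (cell_hypergraphon k q x) (qf_space k) (type_act \<sigma>)"
    by (simp add: cell_hypergraphon_def y)
qed

text \<open>Both conditions hold at every point: the value is a point mass at one of the two types,
  chosen from the singleton coordinates alone.\<close>

lemma induces_borel_cell: "induces_borel_hypergraph k (cell_hypergraphon k q)"
proof -
  have "cell_hypergraphon k q (merge {{i} | i. i < k} R (z, a)) =
      cell_hypergraphon k q (merge {{i} | i. i < k} R (z, b))" for R z a b
  proof -
    have "(\<lambda>i. q (merge {{i} | i. i < k} R (z, a) {i})) ` {..<k} =
        (\<lambda>i. q (merge {{i} | i. i < k} R (z, b) {i})) ` {..<k}"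
      by (rule image_cong) (auto simp: merge_def)
    then show ?thesis unfolding cell_hypergraphon_def cell_type_def by (simp only:)
  qed
  then show ?thesis
    unfolding induces_borel_hypergraph_def Let_def
    by (intro conjI AE_I2) (simp_all only: split_beta, simp add: cell_hypergraphon_def cell_type_def)
qed

section \<open>The sampled structure\<close>

lemma shannon_entropy_pmf:
  assumes sp: "space \<nu> = X" "set_pmf p \<subseteq> X" and fin: "finite (set_pmf p)"
    and meas: "\<And>B. B \<subseteq> X \<Longrightarrow> measure \<nu> B = measure_pmf.prob p B"
  shows "shannon_entropy \<nu> = ennreal (pmf_entropy p)"
proof -
  have single: "measure \<nu> {x} = pmf p x" if "x \<in> X" for x
    using meas[of "{x}"] that by (simp add: measure_pmf_single)
  have A: "{x \<in> space \<nu>. measure \<nu> {x} \<noteq> 0} = set_pmf p"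
    using sp by (auto simp: single set_pmf_iff)
  have "measure \<nu> (set_pmf p) = 1"
    using meas[OF sp(2)] by (simp add: measure_pmf.prob_eq_1 AE_measure_pmf)
  then have "shannon_entropy \<nu> = (\<integral>\<^sup>+ x. ennreal (- measure \<nu> {x} * log 2 (measure \<nu> {x})) \<partial>count_space (set_pmf p))"
    by (simp add: shannon_entropy_def A)
  also have "\<dots> = (\<Sum>x\<in>set_pmf p. ennreal (- measure \<nu> {x} * log 2 (measure \<nu> {x})))"
    by (rule nn_integral_count_space_finite[OF fin])
  also have "\<dots> = (\<Sum>x\<in>set_pmf p. ennreal (- pmf p x * log 2 (pmf p x)))"
    using sp by (intro sum.cong) (auto simp: single subset_iff)
  also have "\<dots> = ennreal (pmf_entropy p)"
    unfolding pmf_entropy_def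
    by (rule sum_ennreal) (rule entropy_summand_nonneg)
  finally show ?thesis .
qed

lemma cell_structure_cong: "(\<And>v. v < n \<Longrightarrow> \<omega> v = \<omega>' v) \<Longrightarrow> cell_structure k n \<omega> = cell_structure k n \<omega>'"
proof -
  assume *: "\<And>v. v < n \<Longrightarrow> \<omega> v = \<omega>' v"
  have "\<omega> ` set a = \<omega>' ` set a" if "set a \<subseteq> {..<n}" for a
    by (rule image_cong) (use that * in auto)
  then show ?thesis unfolding cell_structure_def by auto
qed

lemma cell_structure_in_structures: "cell_structure k n \<omega> \<in> structures k {..<n}"
  by (auto simp: cell_structure_def structures_def)

text \<open>Both measures live on a countable set with all subsets measurable, so agreement on
  singletons suffices.\<close>

lemma PiM_distr_pmf:
  assumes q: "q \<in> unif \<rightarrow>\<^sub>M count_space (set_pmf (cell_pmf m))"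
    and law: "distr unif (count_space UNIV) q = measure_pmf (cell_pmf m)"
  shows "PiM {..<n} (\<lambda>_. distr unif (count_space (set_pmf (cell_pmf m))) q) =
    restrict_space (measure_pmf (cells_pmf m n)) ({..<n} \<rightarrow>\<^sub>E set_pmf (cell_pmf m))"
proof -
  let ?C = "set_pmf (cell_pmf m)"
  let ?D = "distr unif (count_space ?C) q"
  interpret U: prob_space unif by (rule prob_space_unif)
  have D: "prob_space ?D" by (rule U.prob_space_distr[OF q])
  interpret product_prob_space "\<lambda>_ :: nat. ?D" by (rule product_prob_spaceI) (rule D)
  have q': "q \<in> unif \<rightarrow>\<^sub>M count_space UNIV"
    using measurable_compose[OF q, of id "count_space UNIV"] by simp
  have single: "emeasure ?D {c} = ennreal (pmf (cell_pmf m) c)" if "c \<in> ?C" for c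
  proof -
    have "emeasure ?D {c} = emeasure (distr unif (count_space UNIV) q) {c}"
      using that by (simp add: emeasure_distr[OF q] emeasure_distr[OF q'])
    then show ?thesis unfolding law by (simp add: emeasure_pmf_single)
  qed
  have count: "countable ({..<n} \<rightarrow>\<^sub>E ?C)" by (intro countable_PiE) auto
  have "sets (PiM {..<n} (\<lambda>_. ?D)) = sets (PiM {..<n} (\<lambda>_. count_space ?C))"
    by (intro sets_PiM_cong) auto
  also have "\<dots> = Pow ({..<n} \<rightarrow>\<^sub>E ?C)" by (simp add: count_space_PiM_finite)
  finally have sets: "sets (PiM {..<n} (\<lambda>_. ?D)) = Pow ({..<n} \<rightarrow>\<^sub>E ?C)" .
  show ?thesis
  proof (rule measure_eqI_countable[OF sets _ count])
    show "sets (restrict_space (measure_pmf (cells_pmf m n)) ({..<n} \<rightarrow>\<^sub>E ?C)) = Pow ({..<n} \<rightarrow>\<^sub>E ?C)"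
      by (auto simp: sets_restrict_space)
    fix h assume h: "h \<in> {..<n} \<rightarrow>\<^sub>E ?C"
    have "emeasure (PiM {..<n} (\<lambda>_. ?D)) (Pi\<^sub>E {..<n} (\<lambda>v. {h v})) = (\<Prod>v<n. emeasure ?D {h v})"
      using h by (intro emeasure_PiM) (auto simp: PiE_iff)
    also have "Pi\<^sub>E {..<n} (\<lambda>v. {h v}) = {h}"
      using h by (intro PiE_singleton) (auto simp: PiE_def)
    also have "(\<Prod>v<n. emeasure ?D {h v}) = (\<Prod>v<n. ennreal (pmf (cell_pmf m) (h v)))"
      using h by (intro prod.cong refl single) (auto simp: PiE_iff)
    also have "\<dots> = ennreal (\<Prod>v<n. pmf (cell_pmf m) (h v))" by (rule prod_ennreal) simp
    also have "(\<Prod>v<n. pmf (cell_pmf m) (h v)) = pmf (cells_pmf m n) h"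
      using h by (simp add: cells_pmf_def pmf_Pi PiE_iff extensional_def)
    finally show "emeasure (PiM {..<n} (\<lambda>_. ?D)) {h} =
        emeasure (restrict_space (measure_pmf (cells_pmf m n)) ({..<n} \<rightarrow>\<^sub>E ?C)) {h}"
      using h by (simp add: emeasure_restrict_space emeasure_pmf_single)
  qed
qed

text \<open>Reindexing along \<open>v \<mapsto> {v}\<close> discards the other coordinates of the
  cube, and applying \<open>q\<close> coordinatewise turns a product of uniform laws into a product
  of cell laws.\<close>

lemma distr_cells:
  assumes q: "q \<in> unif \<rightarrow>\<^sub>M count_space (set_pmf (cell_pmf m))"
    and law: "distr unif (count_space UNIV) q = measure_pmf (cell_pmf m)" and k: "k \<ge> 1"
  shows "distr (cube (P_le k UNIV)) (PiM {..<n} (\<lambda>_. count_space (set_pmf (cell_pmf m))))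
      (\<lambda>\<zeta>. \<lambda>v\<in>{..<n}. q (\<zeta> {v})) =
    restrict_space (measure_pmf (cells_pmf m n)) ({..<n} \<rightarrow>\<^sub>E set_pmf (cell_pmf m))"
proof -
  let ?C = "set_pmf (cell_pmf m)"
  let ?N = "PiM {..<n} (\<lambda>_. count_space ?C)"
  let ?R = "\<lambda>\<zeta>. \<lambda>v\<in>{..<n}. \<zeta> {v}"
  interpret U: prob_space unif by (rule prob_space_unif)
  have R: "distr (cube (P_le k UNIV)) (PiM {..<n} (\<lambda>_. unif)) ?R = PiM {..<n} (\<lambda>_. unif)"
    using distr_PiM_reindex[of "P_le k UNIV" "\<lambda>_. unif" "\<lambda>v. {v}" "{..<n}"] prob_space_unif k
    by auto
  have Rm: "?R \<in> cube (P_le k UNIV) \<rightarrow>\<^sub>M PiM {..<n} (\<lambda>_. unif)"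
    by (intro measurable_restrict measurable_component_singleton) (use k in auto)
  have cm: "compose {..<n} q \<in> PiM {..<n} (\<lambda>_. unif) \<rightarrow>\<^sub>M ?N"
    unfolding compose_def
    by (intro measurable_restrict measurable_compose[OF _ q] measurable_component_singleton) auto
  have "distr (cube (P_le k UNIV)) ?N (\<lambda>\<zeta>. \<lambda>v\<in>{..<n}. q (\<zeta> {v})) =
      distr (cube (P_le k UNIV)) ?N (compose {..<n} q \<circ> ?R)"
    by (intro distr_cong refl) (auto simp: compose_def)
  also have "\<dots> = distr (PiM {..<n} (\<lambda>_. unif)) ?N (compose {..<n} q)"
    using distr_distr[OF cm Rm] unfolding R by simp
  \<comment> \<open>A pushforward depends on its target only through the measurable sets, so the
    target may carry the image measures.\<close>
  also have "\<dots> = distr (PiM {..<n} (\<lambda>_. unif)) (PiM {..<n} (\<lambda>_. distr unif (count_space ?C) q)) (compose {..<n} q)"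
    by (intro distr_cong refl sets_PiM_cong) auto
  also have "\<dots> = PiM {..<n} (\<lambda>_. distr unif (distr unif (count_space ?C) q) q)"
    by (rule distr_PiM_finite_prob_space') (use q U.prob_space_distr[OF q] prob_space_unif in auto)
  also have "distr unif (distr unif (count_space ?C) q) q = distr unif (count_space ?C) q"
    by (intro distr_cong refl) auto
  finally show ?thesis unfolding PiM_distr_pmf[OF q law] .
qed

section \<open>Reading the sample off its quantifier-free types\<close>

lemma tau_image: "J \<in> P_eq k UNIV \<Longrightarrow> tau J ` {..<k} = J"
  using tau_bij[of J k] by (simp add: bij_betw_def)

lemma measurable_hat:
  assumes J: "J \<in> P_eq k UNIV"
  shows "(\<lambda>\<zeta>. (hat k \<zeta> J, \<zeta> J)) \<in> cube (P_le k UNIV) \<rightarrow>\<^sub>M cube (P_lt k {..<k}) \<Otimes>\<^sub>M unif"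
proof (rule measurable_Pair)
  show "(\<lambda>\<zeta>. hat k \<zeta> J) \<in> cube (P_le k UNIV) \<rightarrow>\<^sub>M cube (P_lt k {..<k})"
    unfolding hat_def
  proof (intro measurable_restrict measurable_component_singleton)
    fix F assume "F \<in> P_lt k {..<k}"
    then show "tau J ` F \<in> P_le k UNIV" using card_image_le[of F "tau J"] by auto
  qed
qed (use J in \<open>auto intro!: measurable_component_singleton\<close>)

lemma Wstar_in_qf_nr:
  assumes "represents k W (Wstar k W)" "\<zeta> \<in> space (cube (P_le k UNIV))" "J \<in> P_eq k UNIV"
  shows "Wstar k W (hat k \<zeta> J, \<zeta> J) \<in> qf_nr k"
  using measurable_space[OF measurable_compose[OF measurable_hat[OF assms(3)], of "Wstar k W" "qf_space k"]] assms(1,2)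
  by (simp add: represents_def)

text \<open>The index list that the increasing enumeration of \<open>set a\<close> maps to
  \<open>a\<close>; through it, membership of \<open>a\<close> is read off the type prescribed for
  \<open>set a\<close>.\<close>

definition coords :: "nat \<Rightarrow> nat list \<Rightarrow> nat list" where
  "coords k a = map (the_inv_into {..<k} (tau (set a))) a"

lemma coords:
  assumes "length a = k" "distinct a"
  shows "length (coords k a) = k" "set (coords k a) \<subseteq> {..<k}" "distinct (coords k a)"
    "map (tau (set a)) (coords k a) = a"
proof -
  have J: "set a \<in> P_eq k UNIV" using assms by (auto simp: distinct_card)
  have inj: "inj_on (tau (set a)) {..<k}" using tau_bij[OF J] by (simp add: bij_betw_def)
  have sub: "set a \<subseteq> tau (set a) ` {..<k}" using tau_image[OF J] by simp
  show map: "map (tau (set a)) (coords k a) = a"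
    unfolding coords_def map_map by (rule map_idI) (use sub f_the_inv_into_f[OF inj] in auto)
  show "distinct (coords k a)" using assms(2) map by (metis distinct_map)
  show "length (coords k a) = k" "set (coords k a) \<subseteq> {..<k}"
    using assms sub the_inv_into_into[OF inj _ subset_refl] by (auto simp: coords_def)
qed

text \<open>\<open>Wstar\<close> takes values in \<open>qf_nr k\<close> at every point of the cube,
  so the description in \<open>sample\<close> always denotes, and each tuple is governed by the type
  at its own underlying set.\<close>

lemma sample_eq:
  assumes W: "represents k W (Wstar k W)" and \<zeta>: "\<zeta> \<in> space (cube (P_le k UNIV))"
  shows "{a \<in> sample k W \<zeta>. set a \<subseteq> {..<n}} = {a. length a = k \<and> distinct a \<and> set a \<subseteq> {..<n} \<and>
    Pos (Rel (coords k a)) \<in> Wstar k W (hat k \<zeta> (set a), \<zeta> (set a))}"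
proof -
  have "sample k W \<zeta> \<in> structures k UNIV \<and>
      (\<forall>J \<in> P_eq k UNIV. qftp k (sample k W \<zeta>) (tau J) = Wstar k W (hat k \<zeta> J, \<zeta> J))"
    unfolding sample_def by (rule theI'[OF sample_unique]) (rule Wstar_in_qf_nr[OF W \<zeta>])
  then have S: "sample k W \<zeta> \<in> structures k UNIV"
    "\<And>J. J \<in> P_eq k UNIV \<Longrightarrow> qftp k (sample k W \<zeta>) (tau J) = Wstar k W (hat k \<zeta> J, \<zeta> J)"
    by blast+
  have "a \<in> sample k W \<zeta> \<longleftrightarrow> Pos (Rel (coords k a)) \<in> Wstar k W (hat k \<zeta> (set a), \<zeta> (set a))"
    if a: "length a = k" "distinct a" for a
  proof -
    have "set a \<in> P_eq k UNIV" using a by (auto simp: distinct_card)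
    from S(2)[OF this, symmetric] show ?thesis using coords[OF a] by (simp add: qftp_def)
  qed
  moreover have "length a = k \<and> distinct a" if "a \<in> sample k W \<zeta>" for a
    using S(1) that by (auto simp: structures_def)
  ultimately show ?thesis by blast
qed

text \<open>Only the finitely many \<open>k\<close>-subsets of \<open>{..<n}\<close> are consulted,
  each through a type from a finite set.\<close>

lemma measurable_sample:
  assumes W: "represents k W (Wstar k W)"
  shows "(\<lambda>\<zeta>. {a \<in> sample k W \<zeta>. set a \<subseteq> {..<n}}) \<in> cube (P_le k UNIV) \<rightarrow>\<^sub>M count_space (structures k {..<n})"
proof -
  define g where "g h = {a. length a = k \<and> distinct a \<and> set a \<subseteq> {..<n} \<and> Pos (Rel (coords k a)) \<in> h (set a)}"
    for h :: "nat set \<Rightarrow> nat literal set"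
  let ?I = "{J. J \<subseteq> {..<n} \<and> card J = k}"
  have "(\<lambda>\<zeta>. g (\<lambda>J\<in>?I. Wstar k W (hat k \<zeta> J, \<zeta> J))) \<in> cube (P_le k UNIV) \<rightarrow>\<^sub>M count_space (structures k {..<n})"
  proof (rule measurable_finite_family[OF _ countable_finite[OF finite_qf_nr]])
    fix J assume "J \<in> ?I"
    then have "J \<in> P_eq k UNIV" using finite_subset by auto
    then show "(\<lambda>\<zeta>. Wstar k W (hat k \<zeta> J, \<zeta> J)) \<in> cube (P_le k UNIV) \<rightarrow>\<^sub>M qf_space k"
      using W by (intro measurable_compose[OF measurable_hat]) (auto simp: represents_def)
  qed (auto simp: g_def structures_def)
  also have "?this \<longleftrightarrow> ?thesis"
  proof (rule measurable_cong)
    fix \<zeta> assume \<zeta>: "\<zeta> \<in> space (cube (P_le k UNIV))"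
    show "g (\<lambda>J\<in>?I. Wstar k W (hat k \<zeta> J, \<zeta> J)) = {a \<in> sample k W \<zeta>. set a \<subseteq> {..<n}}"
      unfolding sample_eq[OF W \<zeta>] g_def by (auto simp: distinct_card)
  qed
  finally show ?thesis .
qed

lemma sets_Collect_eq_count_space:
  assumes f: "f \<in> M \<rightarrow>\<^sub>M count_space X" and g: "g \<in> M \<rightarrow>\<^sub>M count_space X" and X: "countable X"
  shows "{x \<in> space M. f x = g x} \<in> sets M"
proof -
  have "{x \<in> space M. f x = g x} = (\<Union>c\<in>X. (f -` {c} \<inter> space M) \<inter> (g -` {c} \<inter> space M))"
    using measurable_space[OF f] measurable_space[OF g] by auto
  also have "\<dots> \<in> sets M"
    using f g by (intro sets.countable_UN' X sets.Int measurable_sets) auto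
  finally show ?thesis .
qed

text \<open>A variable whose law is a point mass is almost surely constant, so every representation
  agrees with \<open>cell_type\<close> for almost all values of the last coordinate. Fubini and a
  relabelling of the subsets of \<open>J\<close> carry this to the full cube.\<close>

lemma AE_Wstar_cell:
  assumes rep: "represents k (cell_hypergraphon k q) Ws" and J: "J \<in> P_eq k UNIV"
    and u: "cell_type k q \<in> cube (P_lt k {..<k}) \<rightarrow>\<^sub>M qf_space k"
  shows "AE \<zeta> in cube (P_le k UNIV). Ws (hat k \<zeta> J, \<zeta> J) = cell_type k q (hat k \<zeta> J)"
proof -
  let ?L = "P_lt k {..<k}" and ?T = "{..<k}" and ?u = "cell_type k q"
  let ?r = "\<lambda>y. restrict y ?L :: nat set \<Rightarrow> real"
  interpret U: prob_space unif by (rule prob_space_unif)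
  interpret C: prob_space "cube ?L" by (intro prob_space_PiM prob_space_unif)
  interpret UC: pair_sigma_finite unif "cube ?L" ..
  have Ws: "Ws \<in> cube ?L \<Otimes>\<^sub>M unif \<rightarrow>\<^sub>M qf_space k"
    "\<And>t. t \<in> space (cube ?L) \<Longrightarrow> distr unif (qf_space k) (\<lambda>\<zeta>. Ws (t, \<zeta>)) = return (qf_space k) (?u t)"
    using rep by (auto simp: represents_def cell_hypergraphon_def)
  have AE1: "AE x in unif. Ws (t, x) = ?u t" if t: "t \<in> space (cube ?L)" for t
  proof -
    have m: "(\<lambda>x. Ws (t, x)) \<in> unif \<rightarrow>\<^sub>M qf_space k"
      using measurable_compose[OF measurable_Pair1'[OF t] Ws(1)] by simp
    have "AE y in distr unif (qf_space k) (\<lambda>x. Ws (t, x)). y = ?u t"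
      unfolding Ws(2)[OF t] by (subst AE_return) (auto simp: cell_type_in)
    from AE_distrD[OF m this] show ?thesis .
  qed
  have AE2: "AE z in unif \<Otimes>\<^sub>M cube ?L. Ws (snd z, fst z) = ?u (snd z)"
  proof (rule UC.AE_pair_measure)
    have m: "(\<lambda>z. Ws (snd z, fst z)) \<in> unif \<Otimes>\<^sub>M cube ?L \<rightarrow>\<^sub>M qf_space k"
      by (intro measurable_compose[OF _ Ws(1)]) auto
    have m': "(\<lambda>z. ?u (snd z)) \<in> unif \<Otimes>\<^sub>M cube ?L \<rightarrow>\<^sub>M qf_space k"
      by (intro measurable_compose[OF _ u]) auto
    show sets: "{z \<in> space (unif \<Otimes>\<^sub>M cube ?L). Ws (snd z, fst z) = ?u (snd z)} \<in> sets (unif \<Otimes>\<^sub>M cube ?L)"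
      by (rule sets_Collect_eq_count_space[OF m m' countable_finite[OF finite_qf_nr]])
    have "AE t in cube ?L. AE x in unif. Ws (t, x) = ?u t" by (rule AE_I2) (rule AE1)
    then show "AE x in unif. AE t in cube ?L. Ws (snd (x, t), fst (x, t)) = ?u (snd (x, t))"
      using UC.AE_commute[of "\<lambda>x t. Ws (t, x) = ?u t"] sets by simp
  qed
  have ins: "P_le k ?T = insert ?T ?L"
  proof -
    have "F = ?T" if "F \<subseteq> ?T" "card F = k" for F using that by (intro card_subset_eq) auto
    then show ?thesis by (auto simp: le_less)
  qed
  \<comment> \<open>The pair is glued into one point of a cube; its extra coordinate becomes the one
    indexed by \<open>{..<k}\<close>.\<close>
  have AE3: "AE y in cube (insert ?T ?L). Ws (?r y, y ?T) = ?u (?r y)"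
  proof -
    have upd: "(\<lambda>(x, X). X(?T := x)) \<in> unif \<Otimes>\<^sub>M cube ?L \<rightarrow>\<^sub>M cube (insert ?T ?L)"
      unfolding split_beta by (rule measurable_fun_upd[where J = ?L]) simp_all
    have r: "?r \<in> cube (insert ?T ?L) \<rightarrow>\<^sub>M cube ?L"
      by (rule measurable_restrict_subset) auto
    have m: "(\<lambda>y. Ws (?r y, y ?T)) \<in> cube (insert ?T ?L) \<rightarrow>\<^sub>M qf_space k"
      by (intro measurable_compose[OF _ Ws(1)] measurable_Pair r measurable_component_singleton) auto
    have m': "(\<lambda>y. ?u (?r y)) \<in> cube (insert ?T ?L) \<rightarrow>\<^sub>M qf_space k"
      by (rule measurable_compose[OF r u])
    have eq: "distr (unif \<Otimes>\<^sub>M cube ?L) (cube (insert ?T ?L)) (\<lambda>(x, X). X(?T := x)) = cube (insert ?T ?L)"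
      using distr_pair_PiM_eq_PiM[of ?L "\<lambda>_. unif" ?T] prob_space_unif by simp
    have "AE y in distr (unif \<Otimes>\<^sub>M cube ?L) (cube (insert ?T ?L)) (\<lambda>(x, X). X(?T := x)). Ws (?r y, y ?T) = ?u (?r y)"
    proof (subst AE_distr_iff[OF upd])
      show "{y \<in> space (cube (insert ?T ?L)). Ws (?r y, y ?T) = ?u (?r y)} \<in> sets (cube (insert ?T ?L))"
        by (rule sets_Collect_eq_count_space[OF m m' countable_finite[OF finite_qf_nr]])
      show "AE z in unif \<Otimes>\<^sub>M cube ?L. Ws (?r (case z of (x, X) \<Rightarrow> X(?T := x)), (case z of (x, X) \<Rightarrow> X(?T := x)) ?T) =
          ?u (?r (case z of (x, X) \<Rightarrow> X(?T := x)))"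
        using AE2 AE_space
      proof eventually_elim
        case (elim z)
        then have "snd z \<in> extensional ?L" by (auto simp: space_pair_measure space_PiM PiE_def)
        then have "?r ((snd z)(?T := fst z)) = snd z"
          by (auto simp: fun_eq_iff restrict_def extensional_def)
        then show ?case using elim by (simp add: split_beta)
      qed
    qed
    then show ?thesis by (simp only: eq)
  qed
  \<comment> \<open>\<open>tau J\<close> induces an injection of the coordinate sets into
    \<open>P_le k UNIV\<close>, so the selected coordinates are again independent and
    uniform.\<close>
  define f where "f F = tau J ` F" for F
  have inj: "inj_on (tau J) ?T" using tau_bij[OF J] by (simp add: bij_betw_def)
  have injf: "inj_on f (insert ?T ?L)"
    unfolding f_def by (rule inj_on_image) (auto intro: inj_on_subset[OF inj])
  have f: "f \<in> insert ?T ?L \<rightarrow> P_le k UNIV"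
  proof
    fix F assume "F \<in> insert ?T ?L"
    then show "f F \<in> P_le k UNIV" using card_image_le[of F "tau J"] by (auto simp: f_def)
  qed
  let ?f = "\<lambda>\<zeta>. \<lambda>F\<in>insert ?T ?L. \<zeta> (f F)"
  have fm: "?f \<in> cube (P_le k UNIV) \<rightarrow>\<^sub>M cube (insert ?T ?L)"
    by (intro measurable_restrict measurable_component_singleton) (use f in blast)
  have eq: "distr (cube (P_le k UNIV)) (cube (insert ?T ?L)) ?f = cube (insert ?T ?L)"
    by (rule distr_PiM_reindex[OF prob_space_unif injf f])
  have "AE y in distr (cube (P_le k UNIV)) (cube (insert ?T ?L)) ?f. Ws (?r y, y ?T) = ?u (?r y)"
    unfolding eq by (rule AE3)
  from AE_distrD[OF fm this]
  have "AE \<zeta> in cube (P_le k UNIV). Ws (?r (?f \<zeta>), ?f \<zeta> ?T) = ?u (?r (?f \<zeta>))" .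
  moreover have "?r (\<lambda>F\<in>insert ?T ?L. \<zeta> (f F)) = hat k \<zeta> J" for \<zeta>
    by (auto simp: hat_def f_def)
  moreover have "(\<lambda>F\<in>insert ?T ?L. \<zeta> (f F)) ?T = \<zeta> J" for \<zeta> :: "nat set \<Rightarrow> real"
    using tau_image[OF J] by (simp add: f_def)
  ultimately show ?thesis by (simp only:)
qed

lemma Rel_coords_in_cell_type:
  assumes a: "length a = k" "distinct a" "set a \<subseteq> {..<n}" and k: "k \<ge> 2"
  shows "Pos (Rel (coords k a)) \<in> cell_type k q (hat k \<zeta> (set a)) \<longleftrightarrow> a \<in> cell_structure k n (\<lambda>v. q (\<zeta> {v}))"
proof -
  have J: "set a \<in> P_eq k UNIV" using a by (auto simp: distinct_card)
  have "hat k \<zeta> (set a) {i} = \<zeta> {tau (set a) i}" if "i < k" for i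
    using that k by (simp add: hat_def)
  then have "(\<lambda>i. q (hat k \<zeta> (set a) {i})) ` {..<k} = (\<lambda>v. q (\<zeta> {v})) ` tau (set a) ` {..<k}"
    by (simp add: image_image)
  also have "tau (set a) ` {..<k} = set a" by (rule tau_image[OF J])
  finally show ?thesis
    using a Rel_in_type_top[OF coords(1-3)[OF a(1,2)]] Rel_notin_type_bot[OF coords(1-3)[OF a(1,2)]]
    by (simp add: cell_type_def cell_structure_def)
qed

text \<open>Almost surely the sample on \<open>{..<n}\<close> is the structure built from the cells
  \<open>q (\<zeta> {v})\<close>, since only finitely many \<open>k\<close>-sets have to avoid a
  null set; these cells have law \<open>cells_pmf m n\<close>.\<close>

lemma sample_law_cell:
  assumes q: "q \<in> unif \<rightarrow>\<^sub>M count_space (set_pmf (cell_pmf m))"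
    and law: "distr unif (count_space UNIV) q = measure_pmf (cell_pmf m)" and k: "k \<ge> 2"
    and B: "B \<subseteq> structures k {..<n}"
  shows "measure (sample_law k (cell_hypergraphon k q) n) B =
    measure_pmf.prob (map_pmf (cell_structure k n) (cells_pmf m n)) B"
proof -
  let ?C = "set_pmf (cell_pmf m)" and ?M = "cube (P_le k UNIV)" and ?X = "count_space (structures k {..<n})"
  let ?W = "cell_hypergraphon k q"
  let ?N = "PiM {..<n} (\<lambda>_. count_space ?C)" and ?R = "\<lambda>\<zeta>. \<lambda>v\<in>{..<n}. q (\<zeta> {v})"
  let ?\<Omega> = "{..<n} \<rightarrow>\<^sub>E ?C" and ?P = "cells_pmf m n"
  have C: "countable ?C" by simp
  have rep: "represents k ?W (Wstar k ?W)"
    by (rule represents_Wstar[OF ext_hypergraphon_cell[OF q C k]])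
  have qm: "(\<lambda>\<zeta>. q (\<zeta> {v})) \<in> ?M \<rightarrow>\<^sub>M count_space ?C" for v
    by (intro measurable_compose[OF _ q] measurable_component_singleton) (use k in auto)
  have Rm: "?R \<in> ?M \<rightarrow>\<^sub>M ?N" by (intro measurable_restrict qm)
  have gm: "cell_structure k n \<in> ?N \<rightarrow>\<^sub>M ?X"
    using cell_structure_in_structures by (simp add: count_space_PiM_finite)
  have R: "cell_structure k n (?R \<zeta>) = cell_structure k n (\<lambda>v. q (\<zeta> {v}))" for \<zeta> by (rule cell_structure_cong) simp
  have "AE \<zeta> in ?M. \<forall>J\<in>{J. J \<subseteq> {..<n} \<and> card J = k}. Wstar k ?W (hat k \<zeta> J, \<zeta> J) = cell_type k q (hat k \<zeta> J)"
  proof (rule AE_finite_allI)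
    fix J assume "J \<in> {J. J \<subseteq> {..<n} \<and> card J = k}"
    then have "J \<in> P_eq k UNIV" using finite_subset by auto
    then show "AE \<zeta> in ?M. Wstar k ?W (hat k \<zeta> J, \<zeta> J) = cell_type k q (hat k \<zeta> J)"
      by (rule AE_Wstar_cell[OF rep _ measurable_cell_type[OF q C k]])
  qed simp
  then have "AE \<zeta> in ?M. {a \<in> sample k ?W \<zeta>. set a \<subseteq> {..<n}} = cell_structure k n (?R \<zeta>)"
    using AE_space
  proof eventually_elim
    case (elim \<zeta>)
    have "Pos (Rel (coords k a)) \<in> Wstar k ?W (hat k \<zeta> (set a), \<zeta> (set a)) \<longleftrightarrow> a \<in> cell_structure k n (\<lambda>v. q (\<zeta> {v}))"
      if a: "length a = k" "distinct a" "set a \<subseteq> {..<n}" for a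
      using elim(1) a Rel_coords_in_cell_type[OF a k] by (simp add: distinct_card)
    then show ?case unfolding sample_eq[OF rep elim(2)] R by (auto simp: cell_structure_def)
  qed
  then have "sample_law k ?W n = distr ?M ?X (\<lambda>\<zeta>. cell_structure k n (?R \<zeta>))"
    unfolding sample_law_def
    by (intro distr_cong_AE refl measurable_sample[OF rep] measurable_compose[OF Rm gm])
  also have "\<dots> = distr (distr ?M ?N ?R) ?X (cell_structure k n)"
    unfolding distr_distr[OF gm Rm] o_def ..
  also have "distr ?M ?N ?R = restrict_space (measure_pmf ?P) ?\<Omega>"
    using k by (intro distr_cells[OF q law]) simp
  finally have eq: "sample_law k ?W n = distr (restrict_space (measure_pmf ?P) ?\<Omega>) ?X (cell_structure k n)" .
  have gm': "cell_structure k n \<in> restrict_space (measure_pmf ?P) ?\<Omega> \<rightarrow>\<^sub>M ?X"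
    using cell_structure_in_structures by (intro measurable_restrict_space1) auto
  have sub: "set_pmf ?P \<subseteq> ?\<Omega>"
    by (auto simp: cells_pmf_def set_Pi_pmf PiE_dflt_def PiE_iff extensional_def)
  have "measure (sample_law k ?W n) B = measure (restrict_space (measure_pmf ?P) ?\<Omega>) (cell_structure k n -` B \<inter> ?\<Omega>)"
    unfolding eq using B by (subst measure_distr[OF gm']) (auto simp: space_restrict_space)
  also have "\<dots> = measure_pmf.prob ?P (cell_structure k n -` B \<inter> ?\<Omega>)"
    by (rule measure_restrict_space) auto
  also have "\<dots> = measure_pmf.prob ?P (cell_structure k n -` B)"
    using sub by (intro measure_prob_cong_0) (auto simp: set_pmf_iff)
  finally show ?thesis by simp
qed

lemma entropy_fun_cell:
  assumes q: "q \<in> unif \<rightarrow>\<^sub>M count_space (set_pmf (cell_pmf m))"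
    and law: "distr unif (count_space UNIV) q = measure_pmf (cell_pmf m)" and k: "k \<ge> 2"
  shows "entropy_fun k (cell_hypergraphon k q) n = ennreal (pmf_entropy (map_pmf (cell_structure k n) (cells_pmf m n)))"
  unfolding entropy_fun_def
proof (rule shannon_entropy_pmf)
  show "space (sample_law k (cell_hypergraphon k q) n) = structures k {..<n}"
    by (simp add: sample_law_def)
qed (use finite_cell_structures cell_structure_in_structures sample_law_cell[OF q law k] in auto)

section \<open>Choice of the numbers of positions and conclusion\<close>

theorem theorem3p5:
  fixes k :: nat and \<gamma> :: "nat \<Rightarrow> real"
  assumes "k \<ge> 2"
    and "\<And>n. \<gamma> n \<in> {0..1}"
    and "\<gamma> \<longlonglongrightarrow> 0"
  shows "\<exists>W. ext_hypergraphon k W \<and> induces_borel_hypergraph k W \<and>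
    (\<forall>n. entropy_fun k W n < \<infinity>) \<and>
    (\<lambda>n. enn2real (entropy_fun k W n)) \<in> o(\<lambda>n. real n ^ k) \<and>
    (\<lambda>n. enn2real (entropy_fun k W n)) \<in> \<Omega>(\<lambda>n. \<gamma> n * real n ^ k)"
proof -
  \<comment> \<open>From the threshold \<open>N l\<close> on, the bound attainable with level
    \<open>l\<close> dominates \<open>\<gamma>\<close>. Requiring \<open>N l \<ge> l\<close> leaves
    only finitely many levels with \<open>N l \<le> n\<close>.\<close>
  have "\<exists>N\<ge>l. \<forall>n\<ge>N. \<gamma> n \<le> (1/2) ^ (Suc l * k)" for l
  proof -
    have "\<forall>\<^sub>F n in sequentially. \<gamma> n < (1/2) ^ (Suc l * k)"
      by (rule order_tendstoD(2)[OF assms(3)]) simp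
    then obtain N where "\<And>n. n \<ge> N \<Longrightarrow> \<gamma> n < (1/2) ^ (Suc l * k)"
      by (auto simp: eventually_sequentially)
    then show ?thesis by (intro exI[of _ "max l N"]) (auto intro: less_imp_le)
  qed
  then obtain N where N: "\<And>l. N l \<ge> l" "\<And>l n. n \<ge> N l \<Longrightarrow> \<gamma> n \<le> (1/2) ^ (Suc l * k)"
    by metis
  \<comment> \<open>Level \<open>l\<close> has to serve every \<open>n < N (Suc l)\<close>, so
    \<open>m l\<close> is the size demanded by \<open>entropy_cell_structure_ge\<close> at
    \<open>N (Suc l)\<close>; the successor makes it positive.\<close>
  define m where "m l = Suc (2 * (N (Suc l))\<^sup>2 * 2 ^ (Suc l * k))" for l
  have m: "m l > 0" for l by (simp add: m_def)
  obtain q where q: "q \<in> unif \<rightarrow>\<^sub>M count_space (set_pmf (cell_pmf m))"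
    "distr unif (count_space UNIV) q = measure_pmf (cell_pmf m)"
    using ex_unif_pmf by blast
  define H where "H n = pmf_entropy (map_pmf (cell_structure k n) (cells_pmf m n))" for n
  have ent: "entropy_fun k (cell_hypergraphon k q) n = ennreal (H n)" for n
    unfolding H_def by (rule entropy_fun_cell[OF q assms(1)])
  have H0: "H n \<ge> 0" for n unfolding H_def by (rule pmf_entropy_nonneg)
  have small: "H \<in> o(\<lambda>n. real n ^ k)"
    using entropy_cell_structure_smallo[OF m assms(1)] by (simp add: H_def[abs_def])
  have big: "H \<in> \<Omega>(\<lambda>n. \<gamma> n * real n ^ k)"
  proof (rule landau_omega.bigI)
    \<comment> \<open>The factor \<open>k ^ k\<close> comes from bounding \<open>n choose k\<close>
      below by \<open>(n / k) ^ k\<close>, the factor 2 from the collisions.\<close>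
    show "1 / (2 * real k ^ k) > 0" using assms(1) by simp
    show "\<forall>\<^sub>F n in sequentially. norm (H n) \<ge> 1 / (2 * real k ^ k) * norm (\<gamma> n * real n ^ k)"
      using eventually_ge_at_top[of "max k (N 0)"]
    proof eventually_elim
      case (elim n)
      \<comment> \<open>The largest level whose threshold is reached: \<open>N l \<le> n\<close>
        controls \<open>\<gamma> n\<close>, while \<open>n < N (Suc l)\<close> makes
        \<open>m l\<close> large enough. It exists because \<open>n \<ge> N 0\<close>.\<close>
      define l where "l = Max {l. N l \<le> n}"
      have fin: "finite {l. N l \<le> n}"
        by (rule finite_subset[of _ "{..n}"]) (use N(1) in \<open>auto intro: le_trans\<close>)
      have "l \<in> {l. N l \<le> n}" unfolding l_def using fin elim by (intro Max_in) auto
      then have "\<gamma> n \<le> (1/2) ^ (Suc l * k)" by (intro N) simp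
      have "n < N (Suc l)"
      proof (rule ccontr)
        assume "\<not> n < N (Suc l)"
        then have "Suc l \<le> l" unfolding l_def using fin by (intro Max_ge) (auto simp: l_def)
        then show False by simp
      qed
      then have "n\<^sup>2 \<le> (N (Suc l))\<^sup>2" by (intro power_mono) auto
      then have "2 * n\<^sup>2 * 2 ^ (Suc l * k) \<le> m l" unfolding m_def by (intro le_SucI mult_mono) auto
      then have "real (2 * n\<^sup>2 * 2 ^ (Suc l * k)) \<le> real (m l)" by (rule of_nat_mono)
      then have large: "2 * (real n)\<^sup>2 * 2 ^ (Suc l * k) \<le> m l" by simp
      have "1 / (2 * real k ^ k) * (\<gamma> n * real n ^ k) = (real n / real k) ^ k * \<gamma> n / 2"
        by (simp add: power_divide field_simps)
      also have "\<dots> \<le> real (n choose k) * (1/2) ^ (Suc l * k) / 2"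
        using elim assms(2)[of n] \<open>\<gamma> n \<le> (1/2) ^ (Suc l * k)\<close>
        by (intro divide_right_mono mult_mono binomial_ge_n_over_k_pow_k) auto
      also have "\<dots> \<le> H n"
        unfolding H_def using assms(1) by (intro entropy_cell_structure_ge m large) simp
      finally show ?case using H0[of n] assms(2)[of n] by (simp add: abs_mult)
    qed
  qed
  show ?thesis
    using ext_hypergraphon_cell[OF q(1) _ assms(1)] induces_borel_cell[of k q] small big
    by (intro exI[of _ "cell_hypergraphon k q"]) (simp add: ent H0)
qed

end
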